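(* Let $(\mathcal{A},[\cdot,\cdot]_K)$ be the generalized Lie algebra of Contact type built, as in the context, from data $(\mathbb{F},m,\mathcal{J}_p,\Gamma,\varphi_p,\sigma_p)$ satisfying all the conditions listed there. Then $(\mathcal{A},[\cdot,\cdot]_K)$ is a simple Lie algebra.
   Context: **Data.** $\mathbb{F}$ is a field of characteristic $0$, $\mathbb{N}=\{0,1,2,\dots\}$, $n=2m+1$ with $m\ge1$ an integer. For $1\le p\le n$, $\mathcal{J}_p\in\{\{0\},\mathbb{N}\}$, and $\vec{\mathcal{J}}=\mathcal{J}_1\times\cdots\times\mathcal{J}_n$ with componentwise addition. $\Gamma$ is a torsion-free abelian group and $\varphi_1,\dots,\varphi_n:\Gamma\to\mathbb{F}$ are additive homomorphisms. For $p\in\{1,\dots,m\}$ put $p'=m+p$ and $(m+p)'=p$. **Conditions.** - $\bigcap_{p=1}^n\ker\varphi_p=\{0\}$. - For every $p\in\{1,\dots,2m+1\}$: $\varphi_p\not\equiv0$ or $\mathcal{J}_p=\mathbb{N}$. - $\Gamma=\Gamma_1+\Gamma_2$, where $\Gamma_1=\ker\varphi_n$ and $\Gamma_2=\bigcap_{p=1}^{2m}\ker\varphi_p$ (the sum is then direct). - Let $\mho_1=\{p\in\{1,\dots,2m\}\mid\varphi_p\not\equiv0\}$ and $\mho_2=\{1,\dots,2m\}\setminus\mho_1$. For every $q\in\mho_1$: $\Big(\bigcap_{p\in\{1,\dots,2m\},\,p\ne q}\ker\varphi_p|_{\Gamma_1}\Big)\setminus\ker\varphi_q|_{\Gamma_1}\ne\emptyset$.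 - Fixed elements are chosen: for $q\in\mho_1$, $$\sigma_q=\sigma_{q'}\in\Big(\bigcap_{p\in\{1,\dots,2m\}\setminus\{q,q'\}}\ker\varphi_p|_{\Gamma_1}\Big)\setminus\big(\ker\varphi_q|_{\Gamma_1}\cup\ker\varphi_{q'}|_{\Gamma_1}\big),\qquad \varphi_q(\sigma_q)=-1,$$ and $\sigma_p=0$ for $p\in\mho_2$; moreover $\sigma_n\in\Gamma_2$ is any fixed element. (An empty intersection is $\Gamma_1$.) **Construction.** $\mathcal{A}$ is the $\mathbb{F}$-vector space with basis $\{x^{\alpha,\vec i}\mid(\alpha,\vec i)\in\Gamma\times\vec{\mathcal{J}}\}$ and commutative associative product $x^{\alpha,\vec i}\cdot x^{\beta,\vec j}=x^{\alpha+\beta,\vec i+\vec j}$. Write $x_1^\alpha=x^{\alpha,\vec0}$, and let $1_{[p]}$ be the vector with $1$ in position $p$ and $0$ elsewhere. For $1\le p\le n$ let $\partial_p$ be the derivation $$\partial_p(x^{\alpha,\vec i})=\varphi_p(\alpha)x^{\alpha,\vec i}+i_px^{\alpha,\vec i-1_{[p]}},$$ where a basis symbol whose index is not in $\vec{\mathcal{J}}$ is treated as $0$. Let $\partial$ be the derivation $$\partial(x^{\alpha,\vec i})=\Big(\sum_{p\in\mho_1}\varphi_p(\alpha)+\sum_{q\in\mho_2}i_q\Big)x^{\alpha,\vec i}.$$ The bracket on $\mathcal{A}$ is $$[u,v]_K=\sum_{p=1}^mx_1^{\sigma_p}\big(\partial_p(u)\partial_{p'}(v)-\partial_{p'}(u)\partial_p(v)\big)+x_1^{\sigma_n}\big[(2-\partial)(u)\,\partial_n(v)-\partial_n(u)\,(2-\partial)(v)\big]$$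 for $u,v\in\mathcal{A}$; it makes $\mathcal{A}$ a Lie algebra. *)

theory Defs
  imports Complex_Main "HOL-Library.Poly_Mapping" "HOL-Library.Product_Plus"
begin

section \<open>Simple Lie algebras on a subspace of an ambient vector space\<close>

locale lie_algebra = vector_space scale
  for scale :: "'k::field \<Rightarrow> 'v::ab_group_add \<Rightarrow> 'v" +
  fixes L :: "'v set"
    and brk :: "'v \<Rightarrow> 'v \<Rightarrow> 'v"
  assumes subspace_L: "subspace L"
    and brk_closed: "\<lbrakk>u \<in> L; v \<in> L\<rbrakk> \<Longrightarrow> brk u v \<in> L"
    and brk_add_left: "\<lbrakk>u \<in> L; v \<in> L; w \<in> L\<rbrakk> \<Longrightarrow> brk (u + v) w = brk u w + brk v w"
    and brk_add_right: "\<lbrakk>u \<in> L; v \<in> L; w \<in> L\<rbrakk> \<Longrightarrow> brk u (v + w) = brk u v + brk u w"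
    and brk_scale_left: "\<lbrakk>u \<in> L; v \<in> L\<rbrakk> \<Longrightarrow> brk (scale c u) v = scale c (brk u v)"
    and brk_scale_right: "\<lbrakk>u \<in> L; v \<in> L\<rbrakk> \<Longrightarrow> brk u (scale c v) = scale c (brk u v)"
    and brk_self: "u \<in> L \<Longrightarrow> brk u u = 0"
    and jacobi: "\<lbrakk>u \<in> L; v \<in> L; w \<in> L\<rbrakk> \<Longrightarrow>
      brk u (brk v w) + brk v (brk w u) + brk w (brk u v) = 0"
begin

definition lie_ideal :: "'v set \<Rightarrow> bool" where
  "lie_ideal I \<longleftrightarrow> subspace I \<and> I \<subseteq> L \<and> (\<forall>u\<in>L. \<forall>v\<in>I. brk u v \<in> I)"

end

locale simple_lie_algebra = lie_algebra +
  assumes not_abelian: "\<exists>u\<in>L. \<exists>v\<in>L. brk u v \<noteq> 0"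
    and ideals_trivial: "lie_ideal I \<Longrightarrow> I = {0} \<or> I = L"


section \<open>The commutative algebra and its derivations\<close>

text \<open>
  Multi-indices are finitely supported functions \<^typ>\<open>nat \<Rightarrow>\<^sub>0 nat\<close>, with positions
  \<open>1, \<dots>, 2 * m + 1\<close>.  The product of \<^typ>\<open>'g \<times> (nat \<Rightarrow>\<^sub>0 nat) \<Rightarrow>\<^sub>0 'k\<close> is the
  convolution product, so that \<open>xpow \<alpha> i * xpow \<beta> j = xpow (\<alpha> + \<beta>) (i + j)\<close>.
\<close>

type_synonym ('g, 'k) alg = "'g \<times> (nat \<Rightarrow>\<^sub>0 nat) \<Rightarrow>\<^sub>0 'k"

definition multi_indices :: "nat \<Rightarrow> (nat \<Rightarrow> nat set) \<Rightarrow> (nat \<Rightarrow>\<^sub>0 nat) set" where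
  "multi_indices m J =
    {i. Poly_Mapping.keys i \<subseteq> {1..2*m+1} \<and> (\<forall>p\<in>{1..2*m+1}. Poly_Mapping.lookup i p \<in> J p)}"

definition alg_carrier :: "nat \<Rightarrow> (nat \<Rightarrow> nat set) \<Rightarrow> ('g, 'k::zero) alg set" where
  "alg_carrier m J = {u. Poly_Mapping.keys u \<subseteq> UNIV \<times> multi_indices m J}"

definition xpow :: "'g \<Rightarrow> (nat \<Rightarrow>\<^sub>0 nat) \<Rightarrow> ('g, 'k::zero_neq_one) alg" where
  "xpow \<alpha> i = Poly_Mapping.single (\<alpha>, i) 1"

definition scale_alg :: "'k::field \<Rightarrow> ('g, 'k) alg \<Rightarrow> ('g, 'k) alg" where
  "scale_alg c u = Poly_Mapping.map ((*) c) u"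

text \<open>The linear map with prescribed values \<open>f \<alpha> i\<close> on the basis elements \<open>xpow \<alpha> i\<close>.\<close>

definition lin_ext ::
    "('g \<Rightarrow> (nat \<Rightarrow>\<^sub>0 nat) \<Rightarrow> ('g, 'k::field) alg) \<Rightarrow> ('g, 'k) alg \<Rightarrow> ('g, 'k) alg" where
  "lin_ext f u =
    (\<Sum>(\<alpha>, i)\<in>Poly_Mapping.keys u. scale_alg (Poly_Mapping.lookup u (\<alpha>, i)) (f \<alpha> i))"

text \<open>
  On multi-indices, \<open>-\<close> is pointwise truncated subtraction.  For an index \<open>i\<close> in
  \<open>multi_indices m J\<close>, the index \<open>i - 1\<^sub>[\<^sub>p\<^sub>]\<close> leaves \<open>multi_indices m J\<close> only
  when \<open>i\<^sub>p = 0\<close>, in which case the coefficient of the second term vanishes.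
\<close>

definition pd :: "(nat \<Rightarrow> 'g \<Rightarrow> 'k::field) \<Rightarrow> nat \<Rightarrow> ('g, 'k) alg \<Rightarrow> ('g, 'k) alg" where
  "pd \<phi> p = lin_ext (\<lambda>\<alpha> i.
     scale_alg (\<phi> p \<alpha>) (xpow \<alpha> i) +
     scale_alg (of_nat (Poly_Mapping.lookup i p)) (xpow \<alpha> (i - Poly_Mapping.single p 1)))"

definition mho1 :: "nat \<Rightarrow> (nat \<Rightarrow> 'g \<Rightarrow> 'k::zero) \<Rightarrow> nat set" where
  "mho1 m \<phi> = {p \<in> {1..2*m}. \<exists>\<alpha>. \<phi> p \<alpha> \<noteq> 0}"

definition mho2 :: "nat \<Rightarrow> (nat \<Rightarrow> 'g \<Rightarrow> 'k::zero) \<Rightarrow> nat set" where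
  "mho2 m \<phi> = {1..2*m} - mho1 m \<phi>"

definition deg_der :: "nat \<Rightarrow> (nat \<Rightarrow> 'g \<Rightarrow> 'k::field) \<Rightarrow> ('g, 'k) alg \<Rightarrow> ('g, 'k) alg" where
  "deg_der m \<phi> = lin_ext (\<lambda>\<alpha> i.
     scale_alg ((\<Sum>p\<in>mho1 m \<phi>. \<phi> p \<alpha>) + (\<Sum>q\<in>mho2 m \<phi>. of_nat (Poly_Mapping.lookup i q)))
       (xpow \<alpha> i))"


section \<open>The contact bracket\<close>

definition conj_index :: "nat \<Rightarrow> nat \<Rightarrow> nat" where
  "conj_index m p = (if p \<le> m then m + p else p - m)"

definition contact_bracket ::
    "nat \<Rightarrow> (nat \<Rightarrow> 'g::comm_monoid_add \<Rightarrow> 'k::field) \<Rightarrow> (nat \<Rightarrow> 'g) \<Rightarrow>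
     ('g, 'k) alg \<Rightarrow> ('g, 'k) alg \<Rightarrow> ('g, 'k) alg" where
  "contact_bracket m \<phi> \<sigma> u v =
     (\<Sum>p=1..m. xpow (\<sigma> p) 0 *
        (pd \<phi> p u * pd \<phi> (conj_index m p) v - pd \<phi> (conj_index m p) u * pd \<phi> p v)) +
     xpow (\<sigma> (2*m+1)) 0 *
        ((scale_alg 2 u - deg_der m \<phi> u) * pd \<phi> (2*m+1) v -
         pd \<phi> (2*m+1) u * (scale_alg 2 v - deg_der m \<phi> v))"

definition ker :: "('g \<Rightarrow> 'k::zero) \<Rightarrow> 'g set" where
  "ker f = {\<alpha>. f \<alpha> = 0}"

definition Gamma1 :: "nat \<Rightarrow> (nat \<Rightarrow> 'g \<Rightarrow> 'k::zero) \<Rightarrow> 'g set" where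
  "Gamma1 m \<phi> = ker (\<phi> (2*m+1))"

definition Gamma2 :: "nat \<Rightarrow> (nat \<Rightarrow> 'g \<Rightarrow> 'k::zero) \<Rightarrow> 'g set" where
  "Gamma2 m \<phi> = (\<Inter>p\<in>{1..2*m}. ker (\<phi> p))"

text \<open>
  Only the values of \<open>J\<close>, \<open>\<phi>\<close>, \<open>\<sigma>\<close> at \<open>1, \<dots>, 2 * m + 1\<close> matter.  The
  sum in \<open>torsion_free\<close> is the \<open>k\<close>-fold multiple of \<open>\<alpha>\<close>.  The
  assumptions \<open>sigma_pair\<close> to \<open>sigma_zero\<close> force \<open>p\<close> and \<open>conj_index m p\<close> to lie
  both in \<open>mho1 m \<phi>\<close> or both in \<open>mho2 m \<phi>\<close>.
\<close>

locale contact_data =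
  fixes m :: nat
    and J :: "nat \<Rightarrow> nat set"
    and \<phi> :: "nat \<Rightarrow> 'g::ab_group_add \<Rightarrow> 'k::field_char_0"
    and \<sigma> :: "nat \<Rightarrow> 'g"
  assumes m_pos: "m \<ge> 1"
    and J_cases: "p \<in> {1..2*m+1} \<Longrightarrow> J p = {0} \<or> J p = UNIV"
    and torsion_free: "\<lbrakk>k > 0; (\<Sum>j<(k::nat). \<alpha>) = (0::'g)\<rbrakk> \<Longrightarrow> \<alpha> = 0"
    and phi_additive: "p \<in> {1..2*m+1} \<Longrightarrow> additive (\<phi> p)"
    and phi_ker: "(\<Inter>p\<in>{1..2*m+1}. ker (\<phi> p)) = {0}"
    and phi_or_J: "p \<in> {1..2*m+1} \<Longrightarrow> (\<exists>\<alpha>. \<phi> p \<alpha> \<noteq> 0) \<or> J p = UNIV"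
    and Gamma_sum: "\<forall>\<alpha>. \<exists>\<beta>\<in>Gamma1 m \<phi>. \<exists>\<gamma>\<in>Gamma2 m \<phi>. \<alpha> = \<beta> + \<gamma>"
    and phi_independent: "q \<in> mho1 m \<phi> \<Longrightarrow>
      (Gamma1 m \<phi> \<inter> (\<Inter>p\<in>{1..2*m} - {q}. ker (\<phi> p))) - ker (\<phi> q) \<noteq> {}"
    and sigma_pair: "q \<in> mho1 m \<phi> \<Longrightarrow> \<sigma> q = \<sigma> (conj_index m q)"
    and sigma_mem: "q \<in> mho1 m \<phi> \<Longrightarrow>
      \<sigma> q \<in> (Gamma1 m \<phi> \<inter> (\<Inter>p\<in>{1..2*m} - {q, conj_index m q}. ker (\<phi> p)))
              - (ker (\<phi> q) \<union> ker (\<phi> (conj_index m q)))"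
    and sigma_norm: "q \<in> mho1 m \<phi> \<Longrightarrow> \<phi> q (\<sigma> q) = -1"
    and sigma_zero: "p \<in> mho2 m \<phi> \<Longrightarrow> \<sigma> p = 0"
    and sigma_last: "\<sigma> (2*m+1) \<in> Gamma2 m \<phi>"

end

theory Submission
  imports Defs
begin

text \<open>
  Put \<open>Z = x\<^sup>\<sigma> \<partial>\<^sub>n\<close> with \<open>\<sigma> = \<sigma>\<^sub>n\<close> and write \<open>D\<close> for the degree derivation \<open>\<partial>\<close> and
  \<open>P\<close> for the sum over the conjugate pairs.  The contact bracket is then
  \<open>[u, v] = P(u, v) + (2 - D)(u) Z(v) - Z(u) (2 - D)(v)\<close>.  Here \<open>P\<close> is a Poisson bracket,
  homogeneous of degree \<open>-2\<close> for \<open>D\<close> and preserved by \<open>Z\<close>, and \<open>Z\<close> commutes with \<open>D\<close>.  The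
  Jacobi identity follows from these facts alone, and so does the Leibniz rule
  \<open>[u, v w] = [u, v] w + v [u, w] + 2 Z(u) v w\<close>; this is why the locale \<open>jacobi_algebra\<close> takes
  them as its axioms.

  Simplicity is proved in the manner of Herstein, by comparing Lie ideals of \<open>A\<close> with ideals of
  the commutative algebra \<open>A\<close>.  There are three steps.

  \<^item> Differential simplicity.  A nonzero ideal of the commutative algebra that is stable under
    \<open>\<partial>\<^sub>1, \<dots>, \<partial>\<^sub>n\<close> contains \<open>1\<close>, because the \<open>\<phi>\<^sub>p\<close> together separate the points of \<open>\<Gamma>\<close>.  By the
    Leibniz rule, the elements whose multiples all lie in a given Lie ideal \<open>T\<close> form an ideal
    that the bracket, and hence every \<open>\<partial>\<^sub>p\<close>, preserves.  So a Lie ideal containing a nonzero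
    ideal of the commutative algebra is all of \<open>A\<close>
    (\<open>lie_ideal_containing_ideal_is_everything\<close>).

  \<^item> Transporters.  For a nonzero Lie ideal \<open>I\<close>, the set \<open>T = {t. [A, t] \<subseteq> I}\<close> is a Lie ideal
    too, and it contains a nonzero ideal of the commutative algebra
    (\<open>transporter_contains_associative_ideal\<close>).  This is the heart of the proof.  An element
    \<open>g\<close> on which only \<open>\<partial>\<^sub>n\<close> acts gives \<open>(4 - D)(c (2 - D)(u)) \<in> I\<close> for all \<open>u \<in> I\<close> and
    \<open>c \<in> A\<close>; an element \<open>b\<close> on which only one \<open>\<partial>\<^sub>q\<close> with \<open>q \<le> 2 m\<close> acts then removes the
    factor \<open>4 - D\<close>.  Both steps distribute a square, \<open>g\<^sup>2\<close> or \<open>b\<^sup>2\<close>, over nested brackets with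
    the signs of a second difference, which cancels the unwanted terms.  The
    first of them needs an element \<open>u\<close> of \<open>I\<close> with \<open>(2 - D)(u) \<noteq> 0\<close>: if there is none, every \<open>\<partial>\<^sub>p\<close> kills \<open>I\<close>, which makes \<open>I\<close> consist of
    constants, and these have degree \<open>0\<close> rather than \<open>2\<close>.  Hence \<open>T = A\<close>, that is,
    \<open>[A, A] \<subseteq> I\<close>.

  \<^item> Perfectness.  \<open>[A, A] = A\<close> (\<open>derived_algebra_is_everything\<close>).  Up to monomials of lower
    degree, \<open>[A, A]\<close> contains the multiples of \<open>x\<^bsup>\<alpha>,i\<^esup>\<close> by \<open>k\<^sub>q + 1\<close> for \<open>q \<le> 2 m\<close>, where
    \<open>k\<^sub>q = \<phi>\<^sub>q(\<alpha>)\<close> or \<open>k\<^sub>q = i\<^sub>q\<close>, and by \<open>4 - \<Sum>\<^sub>q k\<^sub>q\<close>.  These numbers add up to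
    \<open>2 m + 4 \<noteq> 0\<close>.

  Each of \<open>g\<close> and \<open>b\<close> is an exponential \<open>x\<^sup>\<alpha>\<close> or a coordinate function, depending on whether the
  additive function \<open>\<phi>\<^sub>q\<close> in question vanishes.  The first two steps treat both cases alike.
\<close>

section \<open>Derivations of commutative rings\<close>

definition derivation :: "('a::comm_ring_1 \<Rightarrow> 'a) \<Rightarrow> bool" where
  "derivation f \<longleftrightarrow> (\<forall>u v. f (u + v) = f u + f v) \<and> (\<forall>u v. f (u * v) = f u * v + u * f v)"

lemma derivationI:
  "\<lbrakk>\<And>u v. f (u + v) = f u + f v; \<And>u v. f (u * v) = f u * v + u * f v\<rbrakk> \<Longrightarrow> derivation f"
  by (simp add: derivation_def)

lemma derivation_add: "derivation f \<Longrightarrow> f (u + v) = f u + f v"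
  and derivation_mult: "derivation f \<Longrightarrow> f (u * v) = f u * v + u * f v"
  by (simp_all add: derivation_def)

lemma derivation_0: "derivation f \<Longrightarrow> f 0 = 0"
  using derivation_add[of f 0 0] by simp

lemma derivation_1: "derivation f \<Longrightarrow> f 1 = 0"
  using derivation_mult[of f 1 1] by simp

lemma derivation_minus: "derivation f \<Longrightarrow> f (- u) = - f u"
  using derivation_add[of f u "- u"] derivation_0[of f] by (simp add: add_eq_0_iff)

lemma derivation_diff: "derivation f \<Longrightarrow> f (u - v) = f u - f v"
  using derivation_add[of f u "- v"] derivation_minus[of f v] by simp

lemma derivation_of_nat: "derivation f \<Longrightarrow> f (of_nat k) = 0"
  by (induction k) (simp_all add: derivation_0 derivation_add derivation_1)

lemma derivation_numeral: "derivation f \<Longrightarrow> f (numeral k) = 0"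
  using derivation_of_nat[of f "numeral k"] by simp

lemma derivation_sum: "derivation f \<Longrightarrow> f (sum g S) = (\<Sum>x\<in>S. f (g x))"
  by (induction S rule: infinite_finite_induct) (simp_all add: derivation_0 derivation_add)

lemma derivation_sum_fun:
  assumes "\<And>x. x \<in> S \<Longrightarrow> derivation (f x)"
  shows "derivation (\<lambda>u. \<Sum>x\<in>S. f x u)"
proof (rule derivationI)
  show "(\<Sum>x\<in>S. f x (u + v)) = (\<Sum>x\<in>S. f x u) + (\<Sum>x\<in>S. f x v)" for u v
    by (simp add: derivation_add[OF assms] sum.distrib)
  have "(\<Sum>x\<in>S. f x (u * v)) = (\<Sum>x\<in>S. f x u * v + u * f x v)" for u v
    by (intro sum.cong refl) (simp add: derivation_mult[OF assms])
  then show "(\<Sum>x\<in>S. f x (u * v)) = (\<Sum>x\<in>S. f x u) * v + u * (\<Sum>x\<in>S. f x v)" for u v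
    by (simp add: sum.distrib sum_distrib_left sum_distrib_right)
qed

lemmas derivation_simps =
  derivation_add derivation_mult derivation_0 derivation_1 derivation_minus derivation_diff
  derivation_numeral

lemma unit_mult_eq_0: "x * r = 1 \<Longrightarrow> x * y = 0 \<Longrightarrow> y = (0 :: 'a::comm_ring_1)"
  by (metis mult.commute mult.left_commute mult_1 mult_zero_right)

section \<open>Jacobi algebras\<close>

text \<open>
  The element type is an ambient ring on which the laws of \<open>P\<close>, \<open>Z\<close>, \<open>D\<close> hold without
  restriction; \<open>A\<close> is the subalgebra carrying the Lie algebra.  The scalars act through the ring
  homomorphism \<open>sc\<close>, so that all linear algebra becomes ring arithmetic.
\<close>

locale jacobi_algebra =
  fixes A :: "'a::comm_ring_1 set"
    and sc :: "'k::field_char_0 \<Rightarrow> 'a"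
    and P :: "'a \<Rightarrow> 'a \<Rightarrow> 'a"
    and Z D :: "'a \<Rightarrow> 'a"
  assumes A_add: "\<lbrakk>u \<in> A; v \<in> A\<rbrakk> \<Longrightarrow> u + v \<in> A"
    and A_mult: "\<lbrakk>u \<in> A; v \<in> A\<rbrakk> \<Longrightarrow> u * v \<in> A"
    and A_sc: "sc c \<in> A"
    and A_P: "\<lbrakk>u \<in> A; v \<in> A\<rbrakk> \<Longrightarrow> P u v \<in> A"
    and A_Z: "u \<in> A \<Longrightarrow> Z u \<in> A"
    and A_D: "u \<in> A \<Longrightarrow> D u \<in> A"
    and sc_add: "sc (c + d) = sc c + sc d"
    and sc_mult: "sc (c * d) = sc c * sc d"
    and sc_1: "sc 1 = 1"
    and P_der: "derivation (P u)"
    and Z_der: "derivation Z"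
    and D_der: "derivation D"
    and P_skew: "P v u = - P u v"
    and P_sc: "P u (sc c) = 0"
    and Z_sc: "Z (sc c) = 0"
    and D_sc: "D (sc c) = 0"
    and P_jacobi: "P u (P v w) + P v (P w u) + P w (P u v) = 0"
    and Z_P: "Z (P u v) = P (Z u) v + P u (Z v)"
    and D_P: "D (P u v) = P (D u) v + P u (D v) - 2 * P u v"
    and D_Z: "D (Z u) = Z (D u)"
begin

definition bracket :: "'a \<Rightarrow> 'a \<Rightarrow> 'a" where
  "bracket u v = P u v + (2 * u - D u) * Z v - Z u * (2 * v - D v)"

lemma sc_0: "sc 0 = 0"
  using sc_add[of 0 0] by simp

lemma sc_minus: "sc (- c) = - sc c"
  using sc_add[of c "- c"] sc_0 by (simp add: add_eq_0_iff)

lemma sc_numeral: "sc (numeral k) = numeral k"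
proof -
  have "sc (of_nat n) = of_nat n" for n
    by (induction n) (simp_all add: sc_0 sc_add sc_1)
  from this[of "numeral k"] show ?thesis by simp
qed

lemma P_der_left: "derivation (\<lambda>v. P v u)"
  using P_der[of u] P_skew[of u] P_skew[of _ u] unfolding derivation_def
  by (metis (no_types, lifting) minus_add_distrib mult_minus_left mult_minus_right P_skew)

lemma P_sc_left: "P (sc c) u = 0"
  using P_skew[of "sc c" u] P_sc[of u c] by simp

lemmas der_simps =
  derivation_simps[OF P_der] derivation_simps[OF P_der_left]
  derivation_simps[OF Z_der] derivation_simps[OF D_der]
  P_sc P_sc_left Z_sc D_sc Z_P D_P D_Z

lemma sc_diff: "sc (c - d) = sc c - sc d"
  using sc_add[of c "- d"] by (simp add: sc_minus)

lemma double_eq_0: "u + u = (0::'a) \<Longrightarrow> u = 0"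
proof -
  assume "u + u = 0"
  then have "2 * u = 0" by simp
  then have "sc (1/2) * (sc 2 * u) = 0" by (simp add: sc_numeral)
  then have "sc (1/2 * 2) * u = 0" by (simp only: sc_mult mult.assoc)
  then show "u = 0" by (simp add: sc_1)
qed

lemma P_self: "P u u = 0"
  by (rule double_eq_0) (metis P_skew add.right_inverse)

lemma bracket_self: "bracket u u = 0"
  by (simp add: bracket_def P_self algebra_simps)

theorem bracket_jacobi:
  "bracket u (bracket v w) + bracket v (bracket w u) + bracket w (bracket u v) = 0"
proof -
  have PJ: "P u (P v w) = - P v (P w u) - P w (P u v)"
    using P_jacobi[of u v w] by (simp add: algebra_simps eq_neg_iff_add_eq_0)
  show ?thesis
    unfolding bracket_def
    by (simp add: der_simps PJ
       P_skew[of v u] P_skew[of w u] P_skew[of w v]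
       P_skew[of "D v" u] P_skew[of "D w" u] P_skew[of "D w" v]
       P_skew[of v "D u"] P_skew[of w "D u"] P_skew[of w "D v"]
       P_skew[of "Z v" u] P_skew[of "Z w" u] P_skew[of "Z w" v]
       P_skew[of v "Z u"] P_skew[of w "Z u"] P_skew[of w "Z v"])
      (simp add: algebra_simps)
qed

lemma A_uminus: "u \<in> A \<Longrightarrow> - u \<in> A"
  using A_mult[OF A_sc[of "-1"]] by (simp add: sc_minus sc_1)

lemma A_diff: "\<lbrakk>u \<in> A; v \<in> A\<rbrakk> \<Longrightarrow> u - v \<in> A"
  using A_add[of u "- v"] A_uminus[of v] by simp

lemma A_1: "1 \<in> A"
  using A_sc[of 1] by (simp add: sc_1)

lemma A_0: "0 \<in> A"
  using A_sc[of 0] by (simp add: sc_0)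

lemma A_numeral: "numeral k \<in> A"
  using A_sc[of "numeral k"] by (simp add: sc_numeral)

lemmas A_closed = A_add A_mult A_sc A_P A_Z A_D A_uminus A_diff A_1 A_0 A_numeral

section \<open>Lie ideals and ideals of the commutative algebra\<close>

definition bracket_ideal :: "'a set \<Rightarrow> bool" where
  "bracket_ideal I \<longleftrightarrow> I \<subseteq> A \<and> 0 \<in> I \<and> (\<forall>u\<in>I. \<forall>v\<in>I. u + v \<in> I) \<and>
     (\<forall>c. \<forall>u\<in>I. sc c * u \<in> I) \<and> (\<forall>a\<in>A. \<forall>u\<in>I. bracket a u \<in> I)"

lemma ideal_sub: "bracket_ideal I \<Longrightarrow> u \<in> I \<Longrightarrow> u \<in> A"
  and ideal_0: "bracket_ideal I \<Longrightarrow> 0 \<in> I"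
  and ideal_add: "bracket_ideal I \<Longrightarrow> u \<in> I \<Longrightarrow> v \<in> I \<Longrightarrow> u + v \<in> I"
  and ideal_sc: "bracket_ideal I \<Longrightarrow> u \<in> I \<Longrightarrow> sc c * u \<in> I"
  and ideal_bracket: "bracket_ideal I \<Longrightarrow> a \<in> A \<Longrightarrow> u \<in> I \<Longrightarrow> bracket a u \<in> I"
  unfolding bracket_ideal_def by auto

lemma ideal_uminus: "bracket_ideal I \<Longrightarrow> u \<in> I \<Longrightarrow> - u \<in> I"
  using ideal_sc[of I u "-1"] by (simp add: sc_minus sc_1)

lemma ideal_diff: "bracket_ideal I \<Longrightarrow> u \<in> I \<Longrightarrow> v \<in> I \<Longrightarrow> u - v \<in> I"
  using ideal_add[of I u "- v"] ideal_uminus[of I v] by simp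

lemma ideal_sc_cancel: "bracket_ideal I \<Longrightarrow> sc c * u \<in> I \<Longrightarrow> c \<noteq> 0 \<Longrightarrow> u \<in> I"
  using ideal_sc[of I "sc c * u" "inverse c"]
  by (simp add: mult.assoc[symmetric] sc_mult[symmetric] sc_1)

lemma ideal_numeral: "bracket_ideal I \<Longrightarrow> u \<in> I \<Longrightarrow> numeral k * u \<in> I"
  using ideal_sc[of I u "numeral k"] by (simp add: sc_numeral)

lemma ideal_numeral_cancel: "bracket_ideal I \<Longrightarrow> numeral k * u \<in> I \<Longrightarrow> u \<in> I"
  using ideal_sc_cancel[of I "numeral k" u] by (simp add: sc_numeral)

text \<open>
  The bracket is a derivation in its second argument up to the term \<open>2 Z(u) v w\<close>, which is why
  Lie ideals can be compared with ideals of the commutative algebra.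
\<close>

lemma bracket_leibniz: "bracket u (v * w) = bracket u v * w + v * bracket u w + 2 * Z u * v * w"
  unfolding bracket_def by (simp add: der_simps algebra_simps)

lemma bracket_one: "bracket 1 v = 2 * Z v"
  unfolding bracket_def by (simp add: der_simps)

lemma bracket_right_linear:
  "bracket a (u + v) = bracket a u + bracket a v"
  "bracket a (u - v) = bracket a u - bracket a v"
  "bracket a (sc c * u) = sc c * bracket a u"
  unfolding bracket_def by (simp_all add: der_simps algebra_simps)

text \<open>
  The operator \<open>4 - D\<close> arises from \<open>(2 - D)(u) v + u (2 - D)(v) = (4 - D)(u v)\<close>.
\<close>

definition F :: "'a \<Rightarrow> 'a" where "F y = 4 * y - D y"

lemma F_linear: "F (u + v) = F u + F v" "F (u - v) = F u - F v" "F (sc c * u) = sc c * F u"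
  unfolding F_def by (simp_all add: der_simps algebra_simps)

text \<open>
  In \<open>c [b, w] = [b, c w] - ([b, c] + 2 Z(b) c) w\<close> both terms on the right lie in \<open>T\<close>.  Hence
  the largest ideal of the commutative algebra inside a Lie ideal is again a Lie ideal.
\<close>

lemma associative_core_bracket:
  assumes T: "bracket_ideal T" and b: "b \<in> A"
    and w: "w \<in> A" "\<And>c. c \<in> A \<Longrightarrow> c * w \<in> T" and c: "c \<in> A"
  shows "c * bracket b w \<in> T"
proof -
  have "c * bracket b w = bracket b (c * w) - (bracket b c + 2 * Z b * c) * w"
    by (simp add: bracket_leibniz algebra_simps)
  moreover have "bracket b c + 2 * Z b * c \<in> A"
    unfolding bracket_def using b c by (intro A_closed)
  ultimately show ?thesis
    using T b c w by (simp add: ideal_diff ideal_bracket)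
qed

text \<open>
  Since \<open>I\<close> is a Lie ideal, \<open>[A, t] \<subseteq> I\<close> is itself contained in the transporter.
\<close>

lemma transporter_ideal:
  assumes I: "bracket_ideal I"
  shows "bracket_ideal {t \<in> A. \<forall>a\<in>A. bracket a t \<in> I}"
proof -
  have bracket_0: "bracket a 0 = 0" for a
    unfolding bracket_def by (simp add: der_simps)
  have A_bracket: "bracket a u \<in> A" if "a \<in> A" "u \<in> A" for a u
    unfolding bracket_def using that by (intro A_closed)
  show ?thesis
    unfolding bracket_ideal_def using I A_bracket
    by (auto simp: bracket_0 bracket_right_linear A_closed ideal_0 ideal_add ideal_sc ideal_bracket)
qed

section \<open>The transporter of a Lie ideal\<close>

text \<open>
  Since \<open>[g c, u] = g [c, u] - c Z(g) (2 - D)(u)\<close>, distributing \<open>g\<^sup>2\<close> over the two brackets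
  with the signs of a second difference cancels every term containing \<open>[c, u]\<close>.  What remains
  depends on \<open>c\<close> only through the product \<open>c (2 - D)(u)\<close>, so that varying \<open>c\<close> produces the image
  under \<open>F\<close> of a whole ideal of the commutative algebra.
\<close>

lemma central_second_difference:
  assumes "\<And>v. P g v = 0" "D g = 0"
  shows "bracket (g * g) (bracket c u) - 2 * bracket g (bracket (g * c) u)
      + bracket 1 (bracket (g * g * c) u) =
    - 2 * F (Z g * Z g * c * (2 * u - D u))"
proof -
  have [simp]: "D (Z g) = 0" "P (Z g) v = 0" "P v (Z g) = 0" "P v g = 0"
    "P (Z (Z g)) v = 0" "P v (Z (Z g)) = 0" "D (Z (Z g)) = 0" for v
  proof -
    show 1: "P v g = 0" for v using assms(1)[of v] P_skew[of v g] by simp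
    show "D (Z g) = 0" using assms(2) by (simp add: D_Z derivation_0[OF Z_der])
    then show "D (Z (Z g)) = 0" by (simp add: D_Z derivation_0[OF Z_der])
    have 2: "P (Z g) v = 0" if "\<And>v. P g v = 0" for g v
      using Z_P[of g v] that by (simp add: derivation_0[OF Z_der])
    show 3: "P (Z g) v = 0" for v using 2[OF assms(1)] .
    show "P v (Z g) = 0" for v using 3[of v] P_skew[of v "Z g"] by simp
    show 4: "P (Z (Z g)) v = 0" for v using 2[OF 3] .
    show "P v (Z (Z g)) = 0" for v using 4[of v] P_skew[of v "Z (Z g)"] by simp
  qed
  show ?thesis
    unfolding bracket_def F_def by (simp add: der_simps assms algebra_simps)
qed

text \<open>
  The same second difference, now in an eigenvector \<open>b\<close> of \<open>D\<close> killed by \<open>Z\<close> and applied to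
  \<open>F y, F (b y), F (b\<^sup>2 y)\<close>.  The factor \<open>4 - D\<close> disappears: the right-hand side is, up to the
  scalar \<open>2 d\<close>, the derivation \<open>b (P(b, -) - d b Z)\<close> at \<open>y\<close>.
\<close>

lemma directional_second_difference:
  assumes "Z b = 0" "D b = sc d * b"
  shows "bracket (b * b) (F y) - 2 * bracket b (F (b * y)) + bracket 1 (F (b * b * y)) =
     2 * sc d * b * (P b y - sc d * b * Z y)"
proof -
  have [simp]: "Z (D b) = 0" using D_Z[of b] assms by (simp add: derivation_0[OF D_der])
  have [simp]: "P b b = 0" by (rule P_self)
  show ?thesis
    unfolding bracket_def F_def by (simp add: der_simps assms algebra_simps)
qed

text \<open>
  The derivation from the preceding lemma reappears here next to \<open>F (b P(b, y))\<close>.  Once its value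
  and \<open>F (b\<^sup>2 Z(y))\<close> are known to lie in a Lie ideal, so does \<open>F (b P(b, y))\<close>.
\<close>

lemma directional_square:
  assumes "Z b = 0" "D b = sc d * b"
  shows "bracket (b * b) (F y) =
     2 * F (b * P b y) + (2 - 2 * sc d) * F (b * b * Z y)
       + 4 * (sc d - 1) * (b * (P b y - sc d * b * Z y))"
  unfolding bracket_def F_def using assms by (simp add: der_simps algebra_simps)

text \<open>
  Moving the factor \<open>g\<close> from one argument to the other costs
  \<open>- Z(g) ((2 - D)(b) y + b (2 - D)(y))\<close>.
\<close>

lemma central_exchange:
  assumes "\<And>v. P g v = 0" "D g = 0"
  shows "bracket (g * b) y - bracket b (g * y) = - F (Z g * b * y)"
proof -
  have "P v g = 0" for v using assms(1)[of v] P_skew[of v g] by simp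
  moreover have "D (Z g) = 0" using assms(2) by (simp add: D_Z derivation_0[OF Z_der])
  ultimately show ?thesis
    unfolding bracket_def F_def by (simp add: der_simps assms algebra_simps)
qed

text \<open>
  Let \<open>K\<close> be the ideal of all \<open>y\<close> with \<open>F (A y) \<subseteq> I\<close>; by \<open>central_second_difference\<close> it contains
  \<open>(2 - D)(u)\<close>.  The derivation \<open>W = b (P(b, -) - d b Z)\<close> maps \<open>K\<close> into \<open>I\<close> by
  \<open>directional_second_difference\<close>, and into \<open>K\<close> by \<open>directional_square\<close>.  Since
  \<open>W (g y) - g W y = - d b\<^sup>2 Z(g) y\<close>, subtracting \<open>[a, W (g y)]\<close> from \<open>[g a, W y]\<close> and applying
  \<open>central_exchange\<close> yields \<open>[a, b\<^sup>2 Z(g) y] \<in> I\<close> for all \<open>y\<close> in \<open>K\<close>.  As \<open>Z(g)\<close> is a unit, the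
  transporter of \<open>I\<close> contains \<open>b\<^sup>2 K\<close>.
\<close>

theorem transporter_contains_associative_ideal:
  assumes I: "bracket_ideal I"
    and g: "g \<in> A" "\<And>v. P g v = 0" "D g = 0"
    and h: "h' \<in> A" "Z g * h' = 1"
    and b: "b \<in> A" "Z b = 0" "D b = sc d * b" "d \<noteq> 0" "\<And>y. b * y = 0 \<Longrightarrow> y = 0"
    and u: "u \<in> I" "2 * u - D u \<noteq> 0"
  shows "\<exists>y\<in>A. y \<noteq> 0 \<and> (\<forall>c\<in>A. \<forall>a\<in>A. bracket a (c * y) \<in> I)"
proof -
  define K where "K = {y \<in> A. \<forall>c\<in>A. F (c * y) \<in> I}"
  define e where "e = 2 * u - D u"
  define W where "W y = b * (P b y - sc d * b * Z y)" for y
  have uA: "u \<in> A" using ideal_sub[OF I u(1)] .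
  then have eA: "e \<in> A" unfolding e_def by (intro A_closed)
  have K_F: "c \<in> A \<Longrightarrow> F (c * y) \<in> I" if "y \<in> K" for y c
    using that by (auto simp: K_def)
  have K_F1: "F y \<in> I" if "y \<in> K" for y
    using K_F[OF that A_1] by simp
  have h2: "Z g * Z g * (h' * h' * c) = c" for c
  proof -
    have "Z g * Z g * (h' * h' * c) = (Z g * h') * (Z g * h') * c"
      by (simp add: mult_ac)
    then show ?thesis by (simp add: h)
  qed
  have e_K: "e \<in> K"
  proof -
    have "F (c * e) \<in> I" if c: "c \<in> A" for c
    proof -
      \<comment> \<open>The unit \<open>(Z g)\<^sup>2\<close> produced by the identity is cancelled in advance.\<close>
      define c' where "c' = h' * h' * c"
      have c'A: "c' \<in> A" unfolding c'_def using c h by (intro A_closed)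
      have "bracket (g * g) (bracket c' u) - 2 * bracket g (bracket (g * c') u)
          + bracket 1 (bracket (g * g * c') u) \<in> I"
        using I g c'A u A_1 by (intro ideal_add ideal_diff ideal_numeral ideal_bracket A_mult)
      then have "- 2 * F (Z g * Z g * c' * e) \<in> I"
        unfolding central_second_difference[OF g(2,3)] e_def .
      then have "2 * F (Z g * Z g * c' * e) \<in> I"
        using ideal_uminus[OF I] by force
      then show ?thesis
        using ideal_numeral_cancel[OF I] unfolding c'_def h2 by blast
    qed
    then show ?thesis by (simp add: K_def eA)
  qed
  have K_mult: "a * y \<in> K" if "a \<in> A" "y \<in> K" for a y
    using that by (auto simp: K_def A_mult mult.assoc[symmetric])
  have K_Z: "Z y \<in> K" if y: "y \<in> K" for y
  proof -
    have "F (c * Z y) \<in> I" if c: "c \<in> A" for c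
    proof -
      have "bracket 1 (F (c * y)) \<in> I" using y c by (intro ideal_bracket I A_1 K_F)
      moreover have "bracket 1 (F (c * y)) = 2 * (F (c * Z y) + F (Z c * y))"
        unfolding bracket_one F_def by (simp add: der_simps algebra_simps)
      ultimately have "F (c * Z y) + F (Z c * y) \<in> I"
        using ideal_numeral_cancel[OF I] by metis
      from ideal_diff[OF I this K_F[OF y A_Z[OF c]]] show ?thesis by simp
    qed
    then show ?thesis using y by (simp add: K_def A_Z)
  qed
  have W_A: "W y \<in> A" if "y \<in> A" for y
    unfolding W_def using that b by (intro A_closed)
  have W_mult: "W (x * y) = x * W y + W x * y" for x y
    unfolding W_def by (simp add: der_simps algebra_simps)
  have W_I: "W y \<in> I" if y: "y \<in> K" for y
  proof -
    have "bracket (b * b) (F y) - 2 * bracket b (F (b * y)) + bracket 1 (F (b * b * y)) \<in> I"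
      using I b y A_1
      by (intro ideal_add ideal_diff ideal_numeral ideal_bracket A_mult K_F K_F1)
    then have "2 * sc d * b * (P b y - sc d * b * Z y) \<in> I"
      unfolding directional_second_difference[OF b(2,3)] .
    then have "2 * (sc d * W y) \<in> I"
      by (simp add: W_def mult.assoc)
    then show ?thesis
      using ideal_numeral_cancel[OF I] ideal_sc_cancel[OF I _ b(4)] by blast
  qed
  have F_W: "F (W y) \<in> I" if y: "y \<in> K" for y
  proof -
    have bbZ: "F (b * b * Z y) \<in> I" using b y by (intro K_F K_Z A_mult)
    have "bracket (b * b) (F y) \<in> I" using I b y by (intro ideal_bracket A_mult K_F1)
    moreover have "bracket (b * b) (F y) =
        2 * F (b * P b y) + sc (2 - 2 * d) * F (b * b * Z y) + sc (4 * (d - 1)) * W y"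
    proof -
      have "sc (2 - 2 * d) = 2 - 2 * sc d" "sc (4 * (d - 1)) = 4 * (sc d - 1)"
        by (simp_all add: sc_diff sc_mult sc_numeral sc_1 algebra_simps)
      then show ?thesis
        unfolding directional_square[OF b(2,3)] W_def by simp
    qed
    ultimately have "2 * F (b * P b y) =
        bracket (b * b) (F y) - sc (2 - 2 * d) * F (b * b * Z y) - sc (4 * (d - 1)) * W y"
      and "bracket (b * b) (F y) \<in> I"
      by simp_all
    then have "2 * F (b * P b y) \<in> I"
      using I bbZ W_I[OF y] by (simp add: ideal_diff ideal_sc)
    then have "F (b * P b y) \<in> I"
      using ideal_numeral_cancel[OF I] by blast
    moreover have "F (W y) = F (b * P b y) - sc d * F (b * b * Z y)"
      unfolding W_def F_linear(2)[symmetric] F_linear(3)[symmetric]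
      by (simp add: algebra_simps)
    ultimately show ?thesis
      using I bbZ by (simp add: ideal_diff ideal_sc)
  qed
  have W_K: "W y \<in> K" if y: "y \<in> K" for y
  proof -
    have "F (c * W y) \<in> I" if c: "c \<in> A" for c
    proof -
      have "F (c * W y) = F (W (c * y)) - F (W c * y)"
        by (simp add: W_mult F_linear)
      then show ?thesis
        using I c y by (simp add: ideal_diff F_W K_mult K_F W_A)
    qed
    then show ?thesis using y by (simp add: K_def W_A)
  qed
  have T: "bracket a (b * b * Z g * y) \<in> I" if a: "a \<in> A" and y: "y \<in> K" for a y
  proof -
    have "P b g = 0" using g(2)[of b] P_skew[of b g] by simp
    then have "W g = - (sc d * (b * b * Z g))"
      by (simp add: W_def algebra_simps)
    then have gW: "g * W y = W (g * y) + sc d * (b * b * Z g * y)"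
      by (simp add: W_mult algebra_simps)
    have "bracket (g * a) (W y) - bracket a (g * W y) = - F (Z g * a * W y)"
      by (rule central_exchange[OF g(2,3)])
    then have "sc d * bracket a (b * b * Z g * y) =
        bracket (g * a) (W y) - bracket a (W (g * y)) + F (Z g * a * W y)"
      unfolding gW bracket_right_linear by (simp add: algebra_simps)
    also have "\<dots> \<in> I"
      using I a g y by (intro ideal_add ideal_diff ideal_bracket W_I K_F W_K K_mult A_mult A_Z)
    finally show ?thesis using ideal_sc_cancel[OF I _ b(4)] by blast
  qed
  have "bracket a (c * (b * b * e)) \<in> I" if "c \<in> A" "a \<in> A" for a c
  proof -
    have "b * b * Z g * ((h' * c) * e) = (Z g * h') * (c * (b * b * e))"
      by (simp add: mult_ac)
    then have "c * (b * b * e) = b * b * Z g * ((h' * c) * e)"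
      by (simp add: h)
    then show ?thesis
      using T[OF that(2) K_mult[OF A_mult[OF h(1) that(1)] e_K]] by simp
  qed
  moreover have "b * b * e \<noteq> 0"
    using b(5)[of e] b(5)[of "b * e"] u(2) by (auto simp: e_def mult.assoc)
  moreover have "b * b * e \<in> A" using b eA by (intro A_mult)
  ultimately show ?thesis by blast
qed

end

section \<open>The monomial basis and its derivations\<close>

lemma scale_alg_eq:
  "scale_alg c u = Poly_Mapping.single 0 c * (u :: ('g::comm_monoid_add, 'k::field) alg)"
  unfolding scale_alg_def by (rule mult_map_scale_conv_mult)

lemma scale_alg_single:
  "scale_alg c (Poly_Mapping.single k d :: ('g, 'k::field) alg) = Poly_Mapping.single k (c * d)"
  unfolding scale_alg_def by simp

lemma lookup_scale_alg:
  "Poly_Mapping.lookup (scale_alg c (u :: ('g, 'k::field) alg)) k = c * Poly_Mapping.lookup u k"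
  unfolding scale_alg_def by (simp add: Poly_Mapping.map.rep_eq when_def)

lemma lin_ext_eq_sum:
  fixes u :: "('g, 'k::field) alg"
  assumes "finite S" "Poly_Mapping.keys u \<subseteq> S"
  shows "lin_ext f u = (\<Sum>(\<alpha>, i)\<in>S. scale_alg (Poly_Mapping.lookup u (\<alpha>, i)) (f \<alpha> i))"
proof -
  have "scale_alg 0 v = (0 :: ('g, 'k) alg)" for v
    by (rule poly_mapping_eqI) (simp add: lookup_scale_alg)
  then show ?thesis
    unfolding lin_ext_def using assms
    by (intro sum.mono_neutral_left) (auto simp: in_keys_iff)
qed

lemma lin_ext_add:
  fixes u v :: "('g, 'k::field) alg"
  shows "lin_ext f (u + v) = lin_ext f u + lin_ext f v"
proof -
  let ?S = "Poly_Mapping.keys u \<union> Poly_Mapping.keys v"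
  have "scale_alg (c + d) w = scale_alg c w + scale_alg d w" for c d and w :: "('g, 'k) alg"
    by (rule poly_mapping_eqI) (simp add: lookup_scale_alg lookup_add algebra_simps)
  moreover have "Poly_Mapping.keys (u + v) \<subseteq> ?S" by (rule keys_add)
  ultimately show ?thesis
    by (subst (1 2 3) lin_ext_eq_sum[where S = ?S])
       (auto simp: lookup_add sum.distrib[symmetric] intro!: sum.cong)
qed

lemma lin_ext_single:
  fixes f :: "'g \<Rightarrow> (nat \<Rightarrow>\<^sub>0 nat) \<Rightarrow> ('g, 'k::field) alg"
  shows "lin_ext f (Poly_Mapping.single (\<alpha>, i) c) = scale_alg c (f \<alpha> i)"
  by (subst lin_ext_eq_sum[where S = "{(\<alpha>, i)}"]) auto

lemma alg_induct_on [consumes 1, case_names single add]: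
  fixes u :: "('g, 'k::field) alg"
  assumes u: "Poly_Mapping.keys u \<subseteq> UNIV \<times> M"
    and single: "\<And>\<alpha> i c. i \<in> M \<Longrightarrow> Q (Poly_Mapping.single (\<alpha>, i) c)"
    and zero: "Q 0"
    and add: "\<And>u v. Q u \<Longrightarrow> Q v \<Longrightarrow> Q (u + v)"
  shows "Q u"
proof -
  have "Q (\<Sum>k\<in>S. Poly_Mapping.single k (Poly_Mapping.lookup u k))"
    if "finite S" "S \<subseteq> UNIV \<times> M" for S
    using that by (induction S) (auto simp: zero single add)
  from this[OF finite_keys u] have "Q (\<Sum>k\<in>Poly_Mapping.keys u. Poly_Mapping.single k (Poly_Mapping.lookup u k))" .
  moreover have "(\<Sum>k\<in>Poly_Mapping.keys u. Poly_Mapping.single k (Poly_Mapping.lookup u k)) = u"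
    by (rule poly_mapping_eqI) (simp add: lookup_sum lookup_single when_def in_keys_iff sum.delta)
  ultimately show ?thesis by simp
qed

lemma alg_induct [case_names single add]:
  fixes u :: "('g, 'k::field) alg"
  assumes "\<And>\<alpha> i c. Q (Poly_Mapping.single (\<alpha>, i) c)"
    and "\<And>u v. Q u \<Longrightarrow> Q v \<Longrightarrow> Q (u + v)"
  shows "Q u"
  using assms(1)[of undefined undefined 0] assms
  by (intro alg_induct_on[of u UNIV Q]) auto

lemma additive_ext:
  fixes f h :: "('g, 'k::field) alg \<Rightarrow> 'b::ab_group_add"
  assumes "\<And>u v. f (u + v) = f u + f v" "\<And>u v. h (u + v) = h u + h v"
    and "\<And>\<alpha> i c. f (Poly_Mapping.single (\<alpha>, i) c) = h (Poly_Mapping.single (\<alpha>, i) c)"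
  shows "f u = h u"
  by (induction u rule: alg_induct) (simp_all add: assms)

text \<open>
  Additivity reduces the product rule to monomials, first in one factor and then in the other.
\<close>

lemma derivationI_single:
  fixes f :: "('g::comm_monoid_add, 'k::field) alg \<Rightarrow> ('g, 'k) alg"
  assumes add: "\<And>u v. f (u + v) = f u + f v"
    and mult: "\<And>\<alpha> i c \<beta> j d. f (Poly_Mapping.single (\<alpha>, i) c * Poly_Mapping.single (\<beta>, j) d) =
       f (Poly_Mapping.single (\<alpha>, i) c) * Poly_Mapping.single (\<beta>, j) d +
       Poly_Mapping.single (\<alpha>, i) c * f (Poly_Mapping.single (\<beta>, j) d)"
  shows "derivation f"
proof (rule derivationI[OF add])
  have *: "f (Poly_Mapping.single (\<alpha>, i) c * v) =
       f (Poly_Mapping.single (\<alpha>, i) c) * v + Poly_Mapping.single (\<alpha>, i) c * f v" for \<alpha> i c v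
    by (induction v rule: alg_induct) (simp_all add: mult add distrib_left distrib_right add_ac)
  show "f (u * v) = f u * v + u * f v" for u v
    by (induction u rule: alg_induct) (simp_all add: * add distrib_left distrib_right add_ac)
qed

lemma pd_add: "pd \<phi> p (u + v) = pd \<phi> p u + pd \<phi> p v"
  unfolding pd_def by (rule lin_ext_add)

text \<open>
  On monomials with coefficients; if \<open>i\<^sub>p = 0\<close> the truncated subtraction leaves \<open>i\<close> unchanged, but
  the coefficient of the second term is \<open>0\<close>.
\<close>

lemma pd_single:
  "pd \<phi> p (Poly_Mapping.single (\<alpha>, i) c) = Poly_Mapping.single (\<alpha>, i) (c * \<phi> p \<alpha>) +
     Poly_Mapping.single (\<alpha>, i - Poly_Mapping.single p 1) (c * of_nat (Poly_Mapping.lookup i p))"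
proof -
  have "scale_alg c (u + v) = scale_alg c u + scale_alg c v" for u v :: "('a, 'b) alg"
    by (rule poly_mapping_eqI) (simp add: lookup_scale_alg lookup_add algebra_simps)
  then show ?thesis
    by (simp add: pd_def lin_ext_single xpow_def scale_alg_single)
qed

lemma pd_derivation:
  assumes "additive (\<phi> p)"
  shows "derivation (pd \<phi> p)"
proof (rule derivationI_single[OF pd_add])
  fix \<alpha> \<beta> :: 'a and i j :: "nat \<Rightarrow>\<^sub>0 nat" and c d :: 'b
  let ?e = "Poly_Mapping.single p (1::nat)"
  have shift: "Poly_Mapping.single (\<gamma>, (k - ?e) + l) (x * of_nat (Poly_Mapping.lookup k p)) =
     Poly_Mapping.single (\<gamma>, (k + l) - ?e) (x * of_nat (Poly_Mapping.lookup k p))" for \<gamma> k l and x :: 'b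
  proof (cases "Poly_Mapping.lookup k p = 0")
    case False
    have "(k - ?e) + l = (k + l) - ?e"
      by (rule poly_mapping_eqI) (use False in \<open>auto simp: lookup_add lookup_minus lookup_single when_def\<close>)
    then show ?thesis by simp
  qed simp
  show "pd \<phi> p (Poly_Mapping.single (\<alpha>, i) c * Poly_Mapping.single (\<beta>, j) d) =
       pd \<phi> p (Poly_Mapping.single (\<alpha>, i) c) * Poly_Mapping.single (\<beta>, j) d +
       Poly_Mapping.single (\<alpha>, i) c * pd \<phi> p (Poly_Mapping.single (\<beta>, j) d)"
    using shift[of "\<alpha> + \<beta>" i j "c * d"] shift[of "\<alpha> + \<beta>" j i "c * d"]
    by (simp add: pd_single mult_single distrib_left distrib_right additive.add[OF assms]
        lookup_add single_add add_ac mult_ac)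
qed

text \<open>
  The operator \<open>deg_der\<close> is diagonal in the monomial basis; these are its eigenvalues.
\<close>

definition deg_eigenvalue :: "nat \<Rightarrow> (nat \<Rightarrow> 'g \<Rightarrow> 'k::field) \<Rightarrow> 'g \<Rightarrow> (nat \<Rightarrow>\<^sub>0 nat) \<Rightarrow> 'k" where
  "deg_eigenvalue m \<phi> \<alpha> i = (\<Sum>p\<in>mho1 m \<phi>. \<phi> p \<alpha>) + (\<Sum>q\<in>mho2 m \<phi>. of_nat (Poly_Mapping.lookup i q))"

lemma deg_der_add: "deg_der m \<phi> (u + v) = deg_der m \<phi> u + deg_der m \<phi> v"
  unfolding deg_der_def by (rule lin_ext_add)

lemma deg_der_single:
  "deg_der m \<phi> (Poly_Mapping.single (\<alpha>, i) c) = Poly_Mapping.single (\<alpha>, i) (c * deg_eigenvalue m \<phi> \<alpha> i)"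
  by (simp add: deg_der_def lin_ext_single xpow_def scale_alg_single deg_eigenvalue_def)

lemma deg_der_derivation:
  assumes "\<And>p. p \<in> mho1 m \<phi> \<Longrightarrow> additive (\<phi> p)"
  shows "derivation (deg_der m \<phi>)"
proof (rule derivationI_single[OF deg_der_add])
  fix \<alpha> \<beta> :: 'a and i j :: "nat \<Rightarrow>\<^sub>0 nat" and c d :: 'b
  have "(\<Sum>p\<in>mho1 m \<phi>. \<phi> p (\<alpha> + \<beta>)) = (\<Sum>p\<in>mho1 m \<phi>. \<phi> p \<alpha>) + (\<Sum>p\<in>mho1 m \<phi>. \<phi> p \<beta>)"
    by (simp add: additive.add[OF assms] sum.distrib)
  then have "deg_eigenvalue m \<phi> (\<alpha> + \<beta>) (i + j) = deg_eigenvalue m \<phi> \<alpha> i + deg_eigenvalue m \<phi> \<beta> j"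
    by (simp add: deg_eigenvalue_def lookup_add sum.distrib)
  then show "deg_der m \<phi> (Poly_Mapping.single (\<alpha>, i) c * Poly_Mapping.single (\<beta>, j) d) =
       deg_der m \<phi> (Poly_Mapping.single (\<alpha>, i) c) * Poly_Mapping.single (\<beta>, j) d +
       Poly_Mapping.single (\<alpha>, i) c * deg_der m \<phi> (Poly_Mapping.single (\<beta>, j) d)"
    by (simp add: deg_der_single mult_single single_add[symmetric] algebra_simps)
qed

lemma pd_commute: "pd \<phi> p (pd \<phi> q u) = pd \<phi> q (pd \<phi> p u)"
proof (rule additive_ext[of "\<lambda>u. pd \<phi> p (pd \<phi> q u)"])
  fix \<alpha> :: 'a and i :: "nat \<Rightarrow>\<^sub>0 nat" and c :: 'b
  show "pd \<phi> p (pd \<phi> q (Poly_Mapping.single (\<alpha>, i) c)) = pd \<phi> q (pd \<phi> p (Poly_Mapping.single (\<alpha>, i) c))"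
  proof (cases "p = q")
    case False
    have "i - Poly_Mapping.single p 1 - Poly_Mapping.single q 1 =
        i - Poly_Mapping.single q 1 - Poly_Mapping.single p (1::nat)"
      by (rule poly_mapping_eqI) (simp add: lookup_minus)
    then show ?thesis using False
      by (simp add: pd_single pd_add lookup_minus lookup_single when_def add_ac mult_ac)
  qed simp
qed (simp_all add: pd_add)

text \<open>
  Translation by \<open>k\<close> is injective on exponents.  So monomials are no zero divisors, even where they
  are not invertible.
\<close>

lemma lookup_single_mult:
  fixes y :: "('g::cancel_comm_monoid_add, 'k::field) alg"
  shows "Poly_Mapping.lookup (Poly_Mapping.single k c * y) (k + l) = c * Poly_Mapping.lookup y l"
  by (induction y rule: alg_induct)
    (auto simp: mult_single lookup_single when_def lookup_add distrib_left)

lemma xpow_mult_eq_0: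
  fixes y :: "('g::cancel_comm_monoid_add, 'k::field) alg"
  assumes "xpow \<beta> j * y = 0"
  shows "y = 0"
proof (rule poly_mapping_eqI)
  fix k
  show "Poly_Mapping.lookup y k = Poly_Mapping.lookup 0 k"
    using lookup_single_mult[of "(\<beta>, j)" 1 y k] assms by (simp add: xpow_def)
qed

lemma lookup_pd:
  "Poly_Mapping.lookup (pd \<phi> p u) (\<alpha>, i) = \<phi> p \<alpha> * Poly_Mapping.lookup u (\<alpha>, i) +
     of_nat (Suc (Poly_Mapping.lookup i p)) * Poly_Mapping.lookup u (\<alpha>, i + Poly_Mapping.single p 1)"
proof (induction u rule: alg_induct)
  case (single \<beta> j c)
  let ?e = "Poly_Mapping.single p (1::nat)"
  have "j - ?e = i \<and> Poly_Mapping.lookup j p > 0 \<longleftrightarrow> j = i + ?e"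
  proof
    assume *: "j - ?e = i \<and> Poly_Mapping.lookup j p > 0"
    show "j = i + ?e"
    proof (rule poly_mapping_eqI)
      fix q show "Poly_Mapping.lookup j q = Poly_Mapping.lookup (i + ?e) q"
        using * by (auto simp: lookup_add lookup_minus lookup_single when_def)
    qed
  next
    assume "j = i + ?e"
    then show "j - ?e = i \<and> Poly_Mapping.lookup j p > 0"
      by (simp add: lookup_add)
  qed
  then have "Poly_Mapping.lookup (Poly_Mapping.single (\<beta>, j - ?e) (c * of_nat (Poly_Mapping.lookup j p))) (\<alpha>, i)
      = of_nat (Suc (Poly_Mapping.lookup i p)) * Poly_Mapping.lookup (Poly_Mapping.single (\<beta>, j) c) (\<alpha>, i + ?e)"
    by (cases "Poly_Mapping.lookup j p = 0") (auto simp: lookup_single when_def lookup_add)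
  then show ?case
    by (simp only: pd_single lookup_add) (auto simp: lookup_single when_def)
next
  case (add u v)
  then show ?case by (simp only: pd_add lookup_add) (simp add: algebra_simps)
qed

lemma minus_single_add:
  "Poly_Mapping.lookup i p > 0 \<Longrightarrow> i - Poly_Mapping.single p 1 + Poly_Mapping.single p 1 = (i :: nat \<Rightarrow>\<^sub>0 nat)"
  by (rule poly_mapping_eqI) (auto simp: lookup_add lookup_minus lookup_single when_def)

lemma finite_has_maximizer:
  fixes f :: "'a \<Rightarrow> nat"
  assumes "finite S" "S \<noteq> {}"
  obtains k where "k \<in> S" "\<And>l. l \<in> S \<Longrightarrow> f l \<le> f k"
proof -
  have "Max (f ` S) \<in> f ` S" using assms by simp
  then obtain k where "k \<in> S" "f k = Max (f ` S)" by force
  then show ?thesis using that[of k] assms by simp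
qed

section \<open>The contact bracket comes from a Jacobi algebra\<close>

definition bivec :: "'a::comm_ring_1 \<Rightarrow> ('a \<Rightarrow> 'a) \<Rightarrow> ('a \<Rightarrow> 'a) \<Rightarrow> 'a \<Rightarrow> 'a \<Rightarrow> 'a" where
  "bivec s a b u v = s * (a u * b v - b u * a v)"

text \<open>
  A bivector of rank two spanned by commuting derivations is Poisson for any coefficient \<open>s\<close>.
\<close>

lemma bivec_jacobi_self:
  assumes der: "derivation a" "derivation b" and comm: "\<And>u. b (a u) = a (b u)"
  shows "bivec s a b u (bivec s a b v w) + bivec s a b v (bivec s a b w u)
    + bivec s a b w (bivec s a b u v) = 0"
  unfolding bivec_def
  by (simp add: derivation_simps[OF der(1)] derivation_simps[OF der(2)] comm algebra_simps)

text \<open>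
  Two such bivectors whose derivations all commute, neither differentiating the coefficient of
  the other, have vanishing Schouten bracket; so their sum is Poisson as well.
\<close>

lemma bivec_jacobi_mixed:
  assumes der: "derivation a" "derivation b" "derivation a'" "derivation b'"
    and comm: "\<And>u. b (a u) = a (b u)" "\<And>u. b' (a' u) = a' (b' u)"
      "\<And>u. a' (a u) = a (a' u)" "\<And>u. a' (b u) = b (a' u)"
      "\<And>u. b' (a u) = a (b' u)" "\<And>u. b' (b u) = b (b' u)"
    and s: "a t = 0" "b t = 0" "a' s = 0" "b' s = 0"
  shows "bivec s a b u (bivec t a' b' v w) + bivec s a b v (bivec t a' b' w u)
      + bivec s a b w (bivec t a' b' u v)
    + (bivec t a' b' u (bivec s a b v w) + bivec t a' b' v (bivec s a b w u)
      + bivec t a' b' w (bivec s a b u v)) = 0"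
  unfolding bivec_def
  by (simp add: derivation_simps[OF der(1)] derivation_simps[OF der(2)]
      derivation_simps[OF der(3)] derivation_simps[OF der(4)] comm s algebra_simps)

lemma bivec_derivation:
  assumes "derivation a" "derivation b"
  shows "derivation (bivec s a b u)"
  by (rule derivationI)
    (simp_all add: bivec_def derivation_simps[OF assms(1)] derivation_simps[OF assms(2)] algebra_simps)

lemma double_poly_eq_0: "u + u = 0 \<Longrightarrow> u = (0 :: ('g, 'k::field_char_0) alg)"
proof (rule poly_mapping_eqI)
  fix k assume "u + u = 0"
  then have "Poly_Mapping.lookup (u + u) k = 0" by simp
  then show "Poly_Mapping.lookup u k = Poly_Mapping.lookup 0 k" by (simp add: lookup_add)
qed

context contact_data
begin

abbreviation A :: "('g, 'k) alg set" where "A \<equiv> alg_carrier m J"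
abbreviation cst :: "'k \<Rightarrow> ('g, 'k) alg" where "cst c \<equiv> Poly_Mapping.single 0 c"
abbreviation dd :: "nat \<Rightarrow> ('g, 'k) alg \<Rightarrow> ('g, 'k) alg" where "dd \<equiv> pd \<phi>"
abbreviation D :: "('g, 'k) alg \<Rightarrow> ('g, 'k) alg" where "D \<equiv> deg_der m \<phi>"
abbreviation xs :: "nat \<Rightarrow> ('g, 'k) alg" where "xs p \<equiv> xpow (\<sigma> p) 0"

definition Z :: "('g, 'k) alg \<Rightarrow> ('g, 'k) alg" where
  "Z u = xs (2*m+1) * dd (2*m+1) u"

definition P :: "('g, 'k) alg \<Rightarrow> ('g, 'k) alg \<Rightarrow> ('g, 'k) alg" where
  "P u v = (\<Sum>p=1..m. bivec (xs p) (dd p) (dd (conj_index m p)) u v)"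

lemma conj_index:
  assumes "p \<in> {1..2*m}"
  shows "conj_index m p \<in> {1..2*m}" "conj_index m (conj_index m p) = p" "conj_index m p \<noteq> p"
  using assms by (auto simp: conj_index_def)

lemma mho1_conj: "p \<in> mho1 m \<phi> \<Longrightarrow> conj_index m p \<in> mho1 m \<phi>"
  using sigma_mem[of p] conj_index(1)[of p] by (auto simp: mho1_def ker_def)

lemma mho2_conj: "p \<in> mho2 m \<phi> \<Longrightarrow> conj_index m p \<in> mho2 m \<phi>"
  using mho1_conj[of "conj_index m p"] conj_index[of p] by (auto simp: mho2_def)

text \<open>
  In the second case \<open>\<phi>\<^sub>p = 0\<close>, so the ring contains the coordinate function of index \<open>p\<close>.
\<close>

lemma mho_cases:
  assumes "p \<in> {1..2*m}"
  obtains "p \<in> mho1 m \<phi>" "p \<notin> mho2 m \<phi>" | "p \<in> mho2 m \<phi>" "p \<notin> mho1 m \<phi>" "\<And>\<alpha>. \<phi> p \<alpha> = 0"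
  using assms by (auto simp: mho2_def mho1_def)

lemma sigma_conj: "p \<in> {1..2*m} \<Longrightarrow> \<sigma> (conj_index m p) = \<sigma> p"
  by (rule mho_cases[of p]) (auto simp: sigma_pair sigma_zero mho2_conj)

lemma finite_mho: "finite (mho1 m \<phi>)" "finite (mho2 m \<phi>)"
  by (auto simp: mho1_def mho2_def)

lemma phi_add: "p \<in> {1..2*m+1} \<Longrightarrow> \<phi> p (\<alpha> + \<beta>) = \<phi> p \<alpha> + \<phi> p \<beta>"
  and phi_0: "p \<in> {1..2*m+1} \<Longrightarrow> \<phi> p 0 = 0"
  using phi_additive[of p] by (simp_all add: additive.add additive.zero)

lemma dd_der: "p \<in> {1..2*m+1} \<Longrightarrow> derivation (dd p)"
  by (rule pd_derivation[OF phi_additive])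

lemma D_der: "derivation D"
  by (rule deg_der_derivation, rule phi_additive) (auto simp: mho1_def)

lemma dd_xpow: "dd p (xpow \<alpha> 0) = Poly_Mapping.single (\<alpha>, 0) (\<phi> p \<alpha>)"
  by (simp add: xpow_def pd_single)

lemma cst_mult_single: "cst c * Poly_Mapping.single k d = Poly_Mapping.single k (c * d)"
  using mult_single[of 0 c k d] by simp

lemma cst_mult: "cst (c * d) = cst c * cst d"
  by (simp add: cst_mult_single)

lemma dd_cst: "p \<in> {1..2*m+1} \<Longrightarrow> dd p (cst c) = 0"
  using pd_single[of \<phi> p 0 0 c] phi_0[of p] by (simp add: zero_prod_def)

lemma D_cst: "D (cst c) = 0"
proof -
  have "deg_eigenvalue m \<phi> 0 0 = 0"
    using phi_0 by (auto simp: deg_eigenvalue_def mho1_def intro!: sum.neutral)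
  then show ?thesis using deg_der_single[of m \<phi> 0 0 c] by (simp add: zero_prod_def)
qed

text \<open>
  The amount by which \<open>\<partial>\<^sub>p\<close> lowers the eigenvalue of \<open>D\<close>: on \<open>mho2\<close> the derivation \<open>D\<close> is the Euler
  operator and \<open>\<partial>\<^sub>p\<close> removes a coordinate function, on \<open>mho1\<close> the two commute.
\<close>

definition deg_drop :: "nat \<Rightarrow> 'k" where "deg_drop p = (if p \<in> mho2 m \<phi> then 1 else 0)"

lemma deg_drop_conj: "p \<in> {1..2*m} \<Longrightarrow> deg_drop (conj_index m p) = deg_drop p"
  using mho2_conj[of p] mho2_conj[of "conj_index m p"] conj_index[of p] by (auto simp: deg_drop_def)

lemma deg_eigenvalue_shift:
  assumes "Poly_Mapping.lookup i p > 0"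
  shows "deg_eigenvalue m \<phi> \<alpha> (i - Poly_Mapping.single p 1) = deg_eigenvalue m \<phi> \<alpha> i - deg_drop p"
proof -
  have "of_nat (Poly_Mapping.lookup (i - Poly_Mapping.single p 1) q) =
      (of_nat (Poly_Mapping.lookup i q) - (if q = p then 1 else 0) :: 'k)" for q
    using assms by (auto simp: lookup_minus lookup_single when_def of_nat_diff Suc_leI)
  then have "(\<Sum>q\<in>mho2 m \<phi>. of_nat (Poly_Mapping.lookup (i - Poly_Mapping.single p 1) q)) =
      (\<Sum>q\<in>mho2 m \<phi>. of_nat (Poly_Mapping.lookup i q)) - deg_drop p"
    by (simp only: sum_subtractf sum.delta[OF finite_mho(2)] deg_drop_def)
  then show ?thesis by (simp add: deg_eigenvalue_def)
qed

lemma D_dd: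
  assumes "p \<in> {1..2*m+1}"
  shows "D (dd p u) = dd p (D u) - cst (deg_drop p) * dd p u"
proof (rule additive_ext[of "\<lambda>u. D (dd p u)"])
  fix \<alpha> :: 'g and i :: "nat \<Rightarrow>\<^sub>0 nat" and c :: 'k
  have 1: "deg_drop p * \<phi> p \<alpha> = 0"
    by (auto simp: deg_drop_def mho2_def mho1_def)
  have 2: "of_nat (Poly_Mapping.lookup i p) * deg_eigenvalue m \<phi> \<alpha> (i - Poly_Mapping.single p 1) =
     of_nat (Poly_Mapping.lookup i p) * (deg_eigenvalue m \<phi> \<alpha> i - deg_drop p)"
    using deg_eigenvalue_shift[of i p \<alpha>] by (cases "Poly_Mapping.lookup i p = 0") auto
  have a: "c * \<phi> p \<alpha> * deg_eigenvalue m \<phi> \<alpha> i = c * deg_eigenvalue m \<phi> \<alpha> i * \<phi> p \<alpha> - deg_drop p * (c * \<phi> p \<alpha>)"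
    using 1 by (simp add: algebra_simps)
  have b: "c * of_nat (Poly_Mapping.lookup i p) * deg_eigenvalue m \<phi> \<alpha> (i - Poly_Mapping.single p 1) =
    c * deg_eigenvalue m \<phi> \<alpha> i * of_nat (Poly_Mapping.lookup i p) - deg_drop p * (c * of_nat (Poly_Mapping.lookup i p))"
    using arg_cong[OF 2, of "\<lambda>x. c * x"] by (simp add: algebra_simps)
  show "D (dd p (Poly_Mapping.single (\<alpha>, i) c)) =
     dd p (D (Poly_Mapping.single (\<alpha>, i) c)) - cst (deg_drop p) * dd p (Poly_Mapping.single (\<alpha>, i) c)"
    by (simp only: pd_single deg_der_single deg_der_add distrib_left cst_mult_single a b single_diff)
       (simp add: algebra_simps)
qed (simp_all add: deg_der_add pd_add algebra_simps)

lemma deg_drop_last: "deg_drop (2*m+1) = 0"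
  by (simp add: deg_drop_def mho2_def)

lemma dd_xs:
  assumes "p \<in> {1..2*m}" "q \<in> {1..2*m+1}" "q \<noteq> p" "q \<noteq> conj_index m p"
  shows "dd q (xs p) = 0"
proof -
  have "\<phi> q (\<sigma> p) = 0"
  proof (rule mho_cases[OF assms(1)])
    assume "p \<in> mho1 m \<phi>"
    from sigma_mem[OF this] show ?thesis
      using assms by (cases "q = 2*m+1") (auto simp: ker_def Gamma1_def)
  next
    assume "p \<in> mho2 m \<phi>"
    then show ?thesis using assms by (simp add: sigma_zero phi_0)
  qed
  then show ?thesis by (simp add: dd_xpow)
qed

lemma D_xpow: "D (xpow \<alpha> 0) = cst (\<Sum>p\<in>mho1 m \<phi>. \<phi> p \<alpha>) * xpow \<alpha> 0"
  by (simp add: xpow_def deg_der_single deg_eigenvalue_def cst_mult_single)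

text \<open>
  This value of \<open>D\<close> on \<open>x\<^sup>\<sigma>\<close> with \<open>\<sigma> = \<sigma>\<^sub>p\<close> makes every summand of \<open>P\<close> homogeneous of degree \<open>-2\<close>.
  On \<open>mho1\<close> both \<open>\<phi>\<^sub>p\<close> and its conjugate contribute \<open>-1\<close>; on \<open>mho2\<close> the coefficient is \<open>1\<close>, and the
  two derivatives lower the degree instead.
\<close>

lemma D_xs:
  assumes p: "p \<in> {1..2*m}"
  shows "D (xs p) = cst (2 * deg_drop p - 2) * xs p"
proof (rule mho_cases[OF p])
  assume 1: "p \<in> mho1 m \<phi>" "p \<notin> mho2 m \<phi>"
  let ?c = "conj_index m p"
  have "(\<Sum>q\<in>mho1 m \<phi>. \<phi> q (\<sigma> p)) = (\<Sum>q\<in>{p, ?c}. \<phi> q (\<sigma> p))"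
  proof (rule sum.mono_neutral_right[OF finite_mho(1)])
    show "{p, ?c} \<subseteq> mho1 m \<phi>" using 1 mho1_conj by simp
    show "\<forall>q\<in>mho1 m \<phi> - {p, ?c}. \<phi> q (\<sigma> p) = 0"
      using sigma_mem[OF 1(1)] by (auto simp: ker_def mho1_def)
  qed
  also have "\<dots> = - 2"
    using sigma_norm[OF 1(1)] sigma_norm[OF mho1_conj[OF 1(1)]] conj_index(3)[OF p]
    by (simp add: sigma_conj[OF p] eq_commute[of p])
  finally show ?thesis using 1 by (simp add: D_xpow deg_drop_def)
next
  assume 2: "p \<in> mho2 m \<phi>"
  have "(\<Sum>q\<in>mho1 m \<phi>. \<phi> q 0) = 0"
    by (rule sum.neutral) (auto simp: mho1_def phi_0)
  then show ?thesis using 2 by (simp add: D_xpow sigma_zero deg_drop_def)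
qed

lemma dd_xs_n: "q \<in> {1..2*m} \<Longrightarrow> dd q (xs (2*m+1)) = 0"
  using sigma_last by (auto simp: dd_xpow Gamma2_def ker_def)

lemma D_xs_n: "D (xs (2*m+1)) = 0"
proof -
  have "(\<Sum>q\<in>mho1 m \<phi>. \<phi> q (\<sigma> (2*m+1))) = 0"
    using sigma_last by (intro sum.neutral) (auto simp: Gamma2_def ker_def mho1_def)
  then show ?thesis by (simp only: D_xpow single_zero mult_zero_left)
qed

lemma index_le: "p \<in> {1..m} \<Longrightarrow> p \<in> {1..2*m}" "p \<in> {1..2*m} \<Longrightarrow> p \<in> {1..2*m+1}"
  by auto

lemma conj_index_le: "p \<in> {1..m} \<Longrightarrow> conj_index m p \<in> {1..2*m+1}"
  by (auto simp: conj_index_def)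

lemma Z_bivec:
  assumes p: "p \<in> {1..2*m}"
  shows "Z (bivec (xs p) (dd p) (dd (conj_index m p)) u v) =
    bivec (xs p) (dd p) (dd (conj_index m p)) (Z u) v + bivec (xs p) (dd p) (dd (conj_index m p)) u (Z v)"
proof -
  define q where "q = conj_index m p"
  define n where "n = 2*m+1"
  have q: "q \<in> {1..2*m}" using p conj_index q_def by simp
  have s: "dd n (xs p) = 0"
    using p q by (intro dd_xs[OF p]) (auto simp: n_def q_def[symmetric])
  have z: "dd p (xs n) = 0" "dd q (xs n) = 0"
    using dd_xs_n[OF p] dd_xs_n[OF q] by (auto simp: n_def)
  have c: "dd n (dd p w) = dd p (dd n w)" "dd n (dd q w) = dd q (dd n w)" for w
    by (rule pd_commute)+
  have der: "derivation (dd p)" "derivation (dd q)" "derivation (dd n)"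
    using p q dd_der by (auto simp: n_def)
  show ?thesis
    unfolding Z_def bivec_def q_def[symmetric] n_def[symmetric]
    by (simp add: derivation_simps[OF der(1)] derivation_simps[OF der(2)]
      derivation_simps[OF der(3)] s z c algebra_simps)
qed

lemma D_bivec:
  assumes p: "p \<in> {1..2*m}"
  shows "D (bivec (xs p) (dd p) (dd (conj_index m p)) u v) =
    bivec (xs p) (dd p) (dd (conj_index m p)) (D u) v + bivec (xs p) (dd p) (dd (conj_index m p)) u (D v)
     - 2 * bivec (xs p) (dd p) (dd (conj_index m p)) u v"
proof -
  define q where "q = conj_index m p"
  have q: "q \<in> {1..2*m}" using p conj_index q_def by simp
  have w: "deg_drop q = deg_drop p" using deg_drop_conj[OF p] by (simp add: q_def)
  have s: "D (xs p) = (2 * cst (deg_drop p) - 2) * xs p"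
    unfolding D_xs[OF p] single_diff cst_mult by simp
  have c: "D (dd p w) = dd p (D w) - cst (deg_drop p) * dd p w"
     "D (dd q w) = dd q (D w) - cst (deg_drop p) * dd q w" for w
    using D_dd[of p w] D_dd[of q w] p q w by auto
  show ?thesis
    unfolding bivec_def q_def[symmetric]
    by (simp add: derivation_simps[OF D_der] s c algebra_simps)
qed

lemma P_derivation: "derivation (P u)"
proof -
  have "derivation (\<lambda>v. P u v)"
    unfolding P_def
    by (intro derivation_sum_fun bivec_derivation dd_der conj_index_le index_le)
  then show ?thesis by simp
qed

text \<open>
  Expanding \<open>P\<close> in its rank two summands, the Jacobi expression becomes a double sum of terms \<open>T p q\<close>
  with \<open>T p q + T q p = 0\<close>.
\<close>

lemma P_Poisson: "P u (P v w) + P v (P w u) + P w (P u v) = 0"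
proof -
  define B where "B p = bivec (xs p) (dd p) (dd (conj_index m p))" for p
  define T where "T p q = B p u (B q v w) + B p v (B q w u) + B p w (B q u v)" for p q
  have der: "derivation (dd p)" "derivation (dd (conj_index m p))" if "p \<in> {1..m}" for p
    by (rule dd_der[OF index_le(2)[OF index_le(1)[OF that]]], rule dd_der[OF conj_index_le[OF that]])
  have TT: "T p q + T q p = 0" if pq: "p \<in> {1..m}" "q \<in> {1..m}" for p q
  proof (cases "p = q")
    case True
    have "T p p = 0"
      unfolding T_def B_def
      by (intro bivec_jacobi_self[where a = "dd p" and b = "dd (conj_index m p)"] der pq pd_commute)
    then show ?thesis using True by simp
  next
    case False
    have ne: "p \<noteq> q" "q \<noteq> p" "p \<noteq> conj_index m q" "q \<noteq> conj_index m p"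
        "conj_index m p \<noteq> q" "conj_index m q \<noteq> p" "conj_index m p \<noteq> conj_index m q"
        "conj_index m q \<noteq> conj_index m p"
      using False pq by (auto simp: conj_index_def)
    note mem = index_le(1)[OF pq(1)] index_le(1)[OF pq(2)]
      index_le(2)[OF index_le(1)[OF pq(1)]] index_le(2)[OF index_le(1)[OF pq(2)]]
      conj_index_le[OF pq(1)] conj_index_le[OF pq(2)]
    have s: "dd p (xs q) = 0" "dd (conj_index m p) (xs q) = 0"
        "dd q (xs p) = 0" "dd (conj_index m q) (xs p) = 0"
      by (rule dd_xs; rule mem ne)+
    define a b a' b' where "a = dd p" and "b = dd (conj_index m p)"
      and "a' = dd q" and "b' = dd (conj_index m q)"
    note abs = this
    have der': "derivation a" "derivation b" "derivation a'" "derivation b'"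
      unfolding abs by (rule der[OF pq(1)] der[OF pq(2)])+
    have comm: "b (a u) = a (b u)" "b' (a' u) = a' (b' u)" "a' (a u) = a (a' u)"
        "a' (b u) = b (a' u)" "b' (a u) = a (b' u)" "b' (b u) = b (b' u)" for u
      unfolding abs by (rule pd_commute)+
    have "T p q + T q p = 0"
      unfolding T_def B_def abs[symmetric]
      by (rule bivec_jacobi_mixed[OF der' comm s[folded abs]])
    then show ?thesis .
  qed
  have PP: "P x (P y z) = (\<Sum>p=1..m. \<Sum>q=1..m. B p x (B q y z))" for x y z
    unfolding P_def B_def
    by (intro sum.cong refl derivation_sum bivec_derivation der)
  have "P u (P v w) + P v (P w u) + P w (P u v) = (\<Sum>p=1..m. \<Sum>q=1..m. T p q)"
    unfolding PP T_def sum.distrib ..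
  moreover have "(\<Sum>p=1..m. \<Sum>q=1..m. T p q) + (\<Sum>p=1..m. \<Sum>q=1..m. T p q) = 0"
  proof -
    have "(\<Sum>p=1..m. \<Sum>q=1..m. T p q) + (\<Sum>p=1..m. \<Sum>q=1..m. T p q) =
      (\<Sum>p=1..m. \<Sum>q=1..m. T p q) + (\<Sum>p=1..m. \<Sum>q=1..m. T q p)"
      by (subst (2) sum.swap) simp
    also have "\<dots> = (\<Sum>p=1..m. \<Sum>q=1..m. T p q + T q p)"
      by (simp only: sum.distrib)
    also have "\<dots> = 0" by (intro sum.neutral ballI) (simp add: TT)
    finally show ?thesis .
  qed
  ultimately show ?thesis using double_poly_eq_0 by metis
qed

lemma multi_indices_0: "0 \<in> multi_indices m J"
proof -
  have "0 \<in> J p" if "p \<in> {1..2*m+1}" for p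
    using J_cases[OF that] by auto
  then show ?thesis by (simp add: multi_indices_def)
qed

lemma multi_indices_add:
  assumes "i \<in> multi_indices m J" "j \<in> multi_indices m J"
  shows "i + j \<in> multi_indices m J"
proof -
  have "Poly_Mapping.lookup i p + Poly_Mapping.lookup j p \<in> J p" if p: "p \<in> {1..2*m+1}" for p
  proof -
    have "Poly_Mapping.lookup i p \<in> J p" "Poly_Mapping.lookup j p \<in> J p"
      using assms p unfolding multi_indices_def by blast+
    then show ?thesis using J_cases[OF p] by auto
  qed
  moreover have "Poly_Mapping.keys (i + j) \<subseteq> {1..2*m+1}"
    using keys_add[of i j] assms unfolding multi_indices_def by blast
  ultimately show ?thesis
    unfolding multi_indices_def by (simp add: lookup_add)
qed

text \<open>
  If \<open>i\<^sub>p > 0\<close> then \<open>J p\<close> contains a positive number, so it is all of \<open>\<nat>\<close>; otherwise truncated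
  subtraction changes nothing.
\<close>

lemma multi_indices_lower:
  assumes i: "i \<in> multi_indices m J"
  shows "i - Poly_Mapping.single p 1 \<in> multi_indices m J"
proof -
  have "Poly_Mapping.keys (i - Poly_Mapping.single p 1) \<subseteq> Poly_Mapping.keys i"
    by (auto simp: in_keys_iff lookup_minus)
  moreover have "Poly_Mapping.lookup (i - Poly_Mapping.single p 1) q \<in> J q" if "q \<in> {1..2*m+1}" for q
  proof -
    have "Poly_Mapping.lookup i q \<in> J q" using i that unfolding multi_indices_def by blast
    with J_cases[OF that] show ?thesis by (elim disjE) (simp_all add: lookup_minus)
  qed
  ultimately show ?thesis using i unfolding multi_indices_def by blast
qed

lemma A_single: "i \<in> multi_indices m J \<Longrightarrow> Poly_Mapping.single (\<alpha>, i) c \<in> A"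
  by (auto simp: alg_carrier_def)

lemma A_xpow: "i \<in> multi_indices m J \<Longrightarrow> xpow \<alpha> i \<in> A"
  by (simp add: xpow_def A_single)

lemma A_add: "u \<in> A \<Longrightarrow> v \<in> A \<Longrightarrow> u + v \<in> A"
  using keys_add[of u v] by (auto simp: alg_carrier_def)

lemma A_0: "0 \<in> A"
  by (simp add: alg_carrier_def)

lemma A_mult: "u \<in> A \<Longrightarrow> v \<in> A \<Longrightarrow> u * v \<in> A"
proof -
  assume "u \<in> A" "v \<in> A"
  then have "k + l \<in> UNIV \<times> multi_indices m J"
    if "k \<in> Poly_Mapping.keys u" "l \<in> Poly_Mapping.keys v" for k l
    using that multi_indices_add[of "snd k" "snd l"] by (cases k; cases l) (auto simp: alg_carrier_def)
  then show ?thesis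
    using keys_mult[of u v] unfolding alg_carrier_def by blast
qed

lemma A_cst: "cst c \<in> A"
  using A_single[OF multi_indices_0, of 0 c] by (simp add: zero_prod_def)

lemma A_induct [consumes 1, case_names single add]:
  assumes "u \<in> A"
    and "\<And>\<alpha> i c. i \<in> multi_indices m J \<Longrightarrow> Q (Poly_Mapping.single (\<alpha>, i) c)"
    and "\<And>u v. Q u \<Longrightarrow> Q v \<Longrightarrow> Q (u + v)"
  shows "Q u"
proof (rule alg_induct_on)
  show "Poly_Mapping.keys u \<subseteq> UNIV \<times> multi_indices m J"
    using assms(1) by (simp add: alg_carrier_def)
  show "Q 0" using assms(2)[OF multi_indices_0, of undefined 0] by simp
qed (use assms in auto)

lemma A_dd: "u \<in> A \<Longrightarrow> dd p u \<in> A"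
  by (induction u rule: A_induct)
    (simp_all add: pd_single pd_add A_add A_single multi_indices_lower del: One_nat_def)

lemma A_D: "u \<in> A \<Longrightarrow> D u \<in> A"
  by (induction u rule: A_induct) (simp_all add: deg_der_single deg_der_add A_add A_single)

lemma A_Z: "u \<in> A \<Longrightarrow> Z u \<in> A"
  unfolding Z_def by (intro A_mult A_xpow A_dd multi_indices_0)

lemma A_diff: "u \<in> A \<Longrightarrow> v \<in> A \<Longrightarrow> u - v \<in> A"
  using keys_diff[of u v] by (auto simp: alg_carrier_def)

lemma A_P: "u \<in> A \<Longrightarrow> v \<in> A \<Longrightarrow> P u v \<in> A"
proof -
  assume uv: "u \<in> A" "v \<in> A"
  have "(\<Sum>p\<in>S. bivec (xs p) (dd p) (dd (conj_index m p)) u v) \<in> A" if "finite S" for S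
    using that by (induction S)
      (auto simp: A_0 bivec_def intro!: A_add A_mult A_diff A_dd uv A_xpow multi_indices_0)
  then show ?thesis unfolding P_def by simp
qed

lemma Z_derivation: "derivation Z"
proof -
  have "derivation (dd (2*m+1))" by (rule dd_der) simp
  then show ?thesis
    by (intro derivationI) (simp_all add: Z_def derivation_add derivation_mult algebra_simps)
qed

lemma Z_D: "D (Z u) = Z (D u)"
proof -
  have "D (dd (2*m+1) u) = dd (2*m+1) (D u)"
    using D_dd[of "2*m+1" u] deg_drop_last by simp
  then show ?thesis
    unfolding Z_def derivation_mult[OF D_der] D_xs_n by simp
qed

sublocale jacobi_algebra A cst P Z D
proof
  show "\<And>u v. u \<in> A \<Longrightarrow> v \<in> A \<Longrightarrow> u + v \<in> A" by (rule A_add)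
  show "\<And>u v. u \<in> A \<Longrightarrow> v \<in> A \<Longrightarrow> u * v \<in> A" by (rule A_mult)
  show "\<And>c. cst c \<in> A" by (rule A_cst)
  show "\<And>u v. u \<in> A \<Longrightarrow> v \<in> A \<Longrightarrow> P u v \<in> A" by (rule A_P)
  show "\<And>u. u \<in> A \<Longrightarrow> Z u \<in> A" by (rule A_Z)
  show "\<And>u. u \<in> A \<Longrightarrow> D u \<in> A" by (rule A_D)
  show "\<And>c d. cst (c + d) = cst c + cst d" by (rule single_add)
  show "\<And>c d. cst (c * d) = cst c * cst d" by (rule cst_mult)
  show "cst 1 = 1" by (rule single_one)
  show "\<And>u. derivation (P u)" by (rule P_derivation)
  show "derivation Z" by (rule Z_derivation)
  show "derivation D" by (rule D_der)
  show "P v u = - P u v" for u v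
    unfolding P_def bivec_def sum_negf[symmetric] by (intro sum.cong refl) (simp add: algebra_simps)
  show "P u (cst c) = 0" for u c
    unfolding P_def bivec_def
  proof (intro sum.neutral ballI)
    fix p assume p: "p \<in> {1..m}"
    have "dd p (cst c) = 0" by (rule dd_cst[OF index_le(2)[OF index_le(1)[OF p]]])
    moreover have "dd (conj_index m p) (cst c) = 0" by (rule dd_cst[OF conj_index_le[OF p]])
    ultimately show "xs p * (dd p u * dd (conj_index m p) (cst c) - dd (conj_index m p) u * dd p (cst c)) = 0"
      by simp
  qed
  show "Z (cst c) = 0" for c
    unfolding Z_def by (subst dd_cst) auto
  show "D (cst c) = 0" for c by (rule D_cst)
  show "P u (P v w) + P v (P w u) + P w (P u v) = 0" for u v w by (rule P_Poisson)
  show "Z (P u v) = P (Z u) v + P u (Z v)" for u v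
    unfolding P_def derivation_sum[OF Z_derivation] sum.distrib[symmetric]
    by (intro sum.cong refl Z_bivec) auto
  show "D (P u v) = P (D u) v + P u (D v) - 2 * P u v" for u v
    unfolding P_def derivation_sum[OF D_der] sum.distrib[symmetric] sum_distrib_left sum_subtractf[symmetric]
    by (intro sum.cong refl D_bivec) auto
  show "D (Z u) = Z (D u)" for u by (rule Z_D)
qed

lemma contact_bracket_eq: "contact_bracket m \<phi> \<sigma> u v = bracket u v"
proof -
  have "scale_alg 2 u = 2 * u" for u :: "('g, 'k) alg"
    by (simp add: scale_alg_eq)
  then show ?thesis
    unfolding contact_bracket_def bracket_def P_def bivec_def Z_def by (simp add: algebra_simps)
qed

section \<open>Differential simplicity\<close>

definition total_degree :: "(nat \<Rightarrow>\<^sub>0 nat) \<Rightarrow> nat" where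
  "total_degree i = (\<Sum>p=1..2*m+1. Poly_Mapping.lookup i p)"

lemma total_degree_add: "total_degree (i + j) = total_degree i + total_degree j"
  by (simp add: total_degree_def lookup_add sum.distrib)

lemma total_degree_single: "p \<in> {1..2*m+1} \<Longrightarrow> total_degree (Poly_Mapping.single p k) = k"
  by (simp add: total_degree_def lookup_single when_def sum.delta)

lemma total_degree_minus:
  "p \<in> {1..2*m+1} \<Longrightarrow> Poly_Mapping.lookup i p > 0 \<Longrightarrow> total_degree (i - Poly_Mapping.single p 1) + 1 = total_degree i"
  using total_degree_add[of "i - Poly_Mapping.single p 1" "Poly_Mapping.single p 1"]
  by (simp only: minus_single_add total_degree_single)

lemma phi_all_0: "(\<And>p. p \<in> {1..2*m+1} \<Longrightarrow> \<phi> p \<alpha> = 0) \<Longrightarrow> \<alpha> = 0"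
  using phi_ker unfolding ker_def by blast

text \<open>
  For a monomial \<open>(\<alpha>, i)\<close> of \<open>u\<close> of maximal total degree among those with the same \<open>\<alpha>\<close>, the
  coefficient of \<open>\<partial>\<^sub>p u\<close> is just \<open>\<phi>\<^sub>p(\<alpha>)\<close> times that of \<open>u\<close>.  So all \<open>\<phi>\<^sub>p\<close> vanish at \<open>\<alpha>\<close>, which
  means \<open>\<alpha> = 0\<close>.  Then \<open>\<partial>\<^sub>p\<close> acts as a formal partial derivative, and characteristic \<open>0\<close> excludes
  monomials of positive degree.
\<close>

lemma constant_if_all_dd_0:
  assumes u: "u \<in> A" and dd: "\<And>p. p \<in> {1..2*m+1} \<Longrightarrow> dd p u = 0"
  shows "\<exists>c. u = cst c"
proof -
  have eq: "\<phi> p \<alpha> * Poly_Mapping.lookup u (\<alpha>, i) +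
     of_nat (Suc (Poly_Mapping.lookup i p)) * Poly_Mapping.lookup u (\<alpha>, i + Poly_Mapping.single p 1) = 0"
    if "p \<in> {1..2*m+1}" for p \<alpha> i
    using lookup_pd[of \<phi> p u \<alpha> i] dd[OF that] by simp
  have \<alpha>: "\<alpha> = 0" if "(\<alpha>, i) \<in> Poly_Mapping.keys u" for \<alpha> i
  proof -
    let ?S = "{k \<in> Poly_Mapping.keys u. fst k = \<alpha>}"
    have "finite ?S" "?S \<noteq> {}" using that by auto
    then obtain k where k: "k \<in> ?S" "\<And>l. l \<in> ?S \<Longrightarrow> total_degree (snd l) \<le> total_degree (snd k)"
      using finite_has_maximizer[of ?S "\<lambda>k. total_degree (snd k)"] by blast
    then obtain j where j: "(\<alpha>, j) \<in> Poly_Mapping.keys u" "k = (\<alpha>, j)" by (cases k) auto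
    show ?thesis
    proof (rule phi_all_0)
      fix p assume p: "p \<in> {1..2*m+1}"
      have "(\<alpha>, j + Poly_Mapping.single p 1) \<notin> Poly_Mapping.keys u"
        using k(2)[of "(\<alpha>, j + Poly_Mapping.single p 1)"] j(2) total_degree_single[OF p, of 1]
        by (auto simp: total_degree_add)
      then show "\<phi> p \<alpha> = 0"
        using eq[OF p, of \<alpha> j] j(1) by (simp add: in_keys_iff)
    qed
  qed
  have 0: "i = 0" if k: "(\<alpha>, i) \<in> Poly_Mapping.keys u" for \<alpha> i
  proof (rule ccontr)
    assume "i \<noteq> 0"
    then obtain p where p: "p \<in> Poly_Mapping.keys i"
      by (metis all_not_in_conv keys_eq_empty)
    then have p1: "p \<in> {1..2*m+1}"
      using u k unfolding alg_carrier_def multi_indices_def by blast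
    let ?j = "i - Poly_Mapping.single p 1"
    have i: "?j + Poly_Mapping.single p 1 = i"
      using p by (intro minus_single_add) (simp add: in_keys_iff)
    have "\<phi> p \<alpha> = 0" using \<alpha>[OF k] phi_0[OF p1] by simp
    then have "of_nat (Suc (Poly_Mapping.lookup ?j p)) * Poly_Mapping.lookup u (\<alpha>, i) = 0"
      using eq[OF p1, of \<alpha> ?j] unfolding i by simp
    then show False
      using k by (simp add: in_keys_iff del: of_nat_Suc)
  qed
  have "u = cst (Poly_Mapping.lookup u 0)"
  proof (rule poly_mapping_eqI)
    fix k
    show "Poly_Mapping.lookup u k = Poly_Mapping.lookup (cst (Poly_Mapping.lookup u 0)) k"
      using \<alpha> 0 by (cases k) (auto simp: lookup_single when_def zero_prod_def in_keys_iff)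
  qed
  then show ?thesis by blast
qed

text \<open>
  Multiply \<open>y\<close> by \<open>x\<^bsup>-\<alpha>\<^esup>\<close>, where \<open>\<alpha>\<close> occurs in \<open>y\<close>.  If all \<open>\<partial>\<^sub>p\<close> kill the product, it is a
  nonzero constant.  Otherwise some \<open>\<partial>\<^sub>p\<close> maps it to a nonzero element of \<open>N\<close> that is smaller: the
  component with group exponent \<open>0\<close> loses degree, because \<open>\<phi>\<^sub>p(0) = 0\<close>, and the others do not gain
  any.  Smallness is measured by the number of pairs \<open>(\<alpha>, k)\<close> such that the component at \<open>\<alpha>\<close> has
  degree at least \<open>k\<close>.
\<close>

lemma differential_simplicity:
  assumes N: "N \<subseteq> A" and y: "y \<in> N" "y \<noteq> 0"
    and mult: "\<And>a w. a \<in> A \<Longrightarrow> w \<in> N \<Longrightarrow> a * w \<in> N"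
    and dd: "\<And>p w. p \<in> {1..2*m+1} \<Longrightarrow> w \<in> N \<Longrightarrow> dd p w \<in> N"
  shows "1 \<in> N"
proof -
  define W :: "('g, 'k) alg \<Rightarrow> ('g \<times> nat) set"
    where "W y = {(\<alpha>, k). \<exists>i. (\<alpha>, i) \<in> Poly_Mapping.keys y \<and> k \<le> total_degree i}" for y
  have fin: "finite (W y)" for y
  proof -
    have "W y = (\<Union>x\<in>Poly_Mapping.keys y. {fst x} \<times> {..total_degree (snd x)})"
      by (force simp: W_def)
    then show ?thesis by simp
  qed
  show ?thesis using y
  proof (induction "card (W y)" arbitrary: y rule: less_induct)
    case less
    obtain \<alpha> i where \<alpha>: "(\<alpha>, i) \<in> Poly_Mapping.keys y"
      using less.prems by (metis all_not_in_conv keys_eq_empty surj_pair)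
    define z where "z = xpow (- \<alpha>) 0 * y"
    have zN: "z \<in> N"
      unfolding z_def by (intro mult A_xpow multi_indices_0 less.prems)
    have z0: "z \<noteq> 0" using xpow_mult_eq_0 less.prems unfolding z_def by blast
    have keys_z: "(\<beta> + \<alpha>, j) \<in> Poly_Mapping.keys y" if "(\<beta>, j) \<in> Poly_Mapping.keys z" for \<beta> j
      using that lookup_single_mult[of "(- \<alpha>, 0)" 1 y "(\<beta> + \<alpha>, j)"]
      by (simp add: z_def xpow_def in_keys_iff)
    have "W z \<subseteq> (\<lambda>(\<beta>, k). (\<beta> - \<alpha>, k)) ` W y"
      using keys_z by (force simp: W_def)
    then have card: "card (W z) \<le> card (W y)"
      using card_mono[OF finite_imageI[OF fin]] card_image_le[OF fin] by (metis le_trans)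
    have \<alpha>z: "(0, i) \<in> Poly_Mapping.keys z"
      using \<alpha> lookup_single_mult[of "(- \<alpha>, 0)" 1 y "(\<alpha>, i)"]
      by (simp add: z_def xpow_def in_keys_iff)
    show ?case
    proof (cases "\<forall>p\<in>{1..2*m+1}. dd p z = 0")
      case True
      then obtain c where c: "z = cst c" using constant_if_all_dd_0[of z] N zN by blast
      then have "c \<noteq> 0" using z0 by auto
      then have "cst (inverse c) * z = 1"
        unfolding c by (simp add: cst_mult[symmetric])
      then show ?thesis using mult[OF A_cst zN, of "inverse c"] by simp
    next
      case False
      then obtain p where p: "p \<in> {1..2*m+1}" "dd p z \<noteq> 0" by blast
      have keys: "(\<beta>, j) \<in> Poly_Mapping.keys z \<and> \<beta> \<noteq> 0 \<or> (\<beta>, j + Poly_Mapping.single p 1) \<in> Poly_Mapping.keys z"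
        if "(\<beta>, j) \<in> Poly_Mapping.keys (dd p z)" for \<beta> j
        using that lookup_pd[of \<phi> p z \<beta> j] phi_0[OF p(1)] by (auto simp: in_keys_iff)
      have deg: "total_degree (j + Poly_Mapping.single p 1) = total_degree j + 1" for j
        using total_degree_single[OF p(1), of 1] by (simp add: total_degree_add)
      have sub: "W (dd p z) \<subseteq> W z"
      proof clarify
        fix \<beta> k assume "(\<beta>, k) \<in> W (dd p z)"
        then obtain j where j: "(\<beta>, j) \<in> Poly_Mapping.keys (dd p z)" "k \<le> total_degree j"
          by (auto simp: W_def)
        then show "(\<beta>, k) \<in> W z"
          using keys[OF j(1)] deg[of j] unfolding W_def by fastforce
      qed
      let ?S = "{k \<in> Poly_Mapping.keys z. fst k = 0}"
      have "finite ?S" "?S \<noteq> {}" using \<alpha>z by auto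
      then obtain k where k: "k \<in> ?S" "\<And>l. l \<in> ?S \<Longrightarrow> total_degree (snd l) \<le> total_degree (snd k)"
        using finite_has_maximizer[of ?S "\<lambda>k. total_degree (snd k)"] by blast
      have "(0, total_degree (snd k)) \<in> W z"
        using k(1) by (cases k) (auto simp: W_def)
      moreover have "(0, total_degree (snd k)) \<notin> W (dd p z)"
      proof
        assume "(0, total_degree (snd k)) \<in> W (dd p z)"
        then obtain j where j: "(0, j) \<in> Poly_Mapping.keys (dd p z)" "total_degree (snd k) \<le> total_degree j"
          by (auto simp: W_def)
        then have "(0, j + Poly_Mapping.single p 1) \<in> ?S" using keys by auto
        from k(2)[OF this] j(2) show False by (simp add: deg del: One_nat_def)
      qed
      ultimately have "card (W (dd p z)) < card (W z)"
        using sub by (intro psubset_card_mono fin) blast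
      then show ?thesis
        using card less.hyps[of "dd p z"] dd[OF p(1) zN] p(2) by simp
    qed
  qed
qed

section \<open>Elements on which a single derivation acts\<close>

lemma cst_cancel: "cst c * x = 0 \<Longrightarrow> c \<noteq> 0 \<Longrightarrow> x = 0"
  by (rule unit_mult_eq_0[of "cst c" "cst (inverse c)"]) (simp_all add: cst_mult[symmetric])

text \<open>
  Elements adapted to the single derivation \<open>\<partial>\<^sub>q\<close>.  The eigenvalue \<open>2\<close> is excluded because
  \<open>(2 - D)(b) = 0\<close> would remove \<open>Z(u)\<close> from the bracket \<open>[b, u]\<close>.
\<close>

definition direction :: "nat \<Rightarrow> ('g, 'k) alg \<Rightarrow> 'k \<Rightarrow> bool" where
  "direction q b d \<longleftrightarrow> (\<exists>\<beta>. \<exists>j\<in>multi_indices m J. b = xpow \<beta> j) \<and>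
     (\<forall>r\<in>{1..2*m+1} - {q}. dd r b = 0) \<and> (\<exists>r\<in>A. dd q b * r = 1) \<and>
     D b = cst d * b \<and> d \<noteq> 0 \<and> d \<noteq> 2"

lemma xpow_mult: "xpow \<alpha> i * xpow \<beta> j = (xpow (\<alpha> + \<beta>) (i + j) :: ('g, 'k) alg)"
  by (simp add: xpow_def mult_single)

lemma xpow_0: "xpow 0 0 = (1 :: ('g, 'k) alg)"
  by (simp add: xpow_def zero_prod_def[symmetric])

lemma xpow_unit: "xpow \<alpha> 0 * xpow (- \<alpha>) 0 = (1 :: ('g, 'k) alg)"
  by (simp add: xpow_mult xpow_0)

text \<open>
  On \<open>mho1\<close> the independence of the \<open>\<phi>\<^sub>p\<close> provides an exponential \<open>x\<^sup>\<alpha>\<close>, and \<open>\<alpha>\<close> or \<open>2 \<alpha>\<close> has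
  eigenvalue other than \<open>2\<close>.  On \<open>mho2\<close> the coordinate function of index \<open>q\<close> has eigenvalue \<open>1\<close>.
\<close>

lemma direction_exists:
  assumes q: "q \<in> {1..2*m}"
  shows "\<exists>b d. direction q b d"
proof (rule mho_cases[OF q])
  assume q1: "q \<in> mho1 m \<phi>"
  from phi_independent[OF q1] obtain \<alpha> where \<alpha>: "\<phi> (2*m+1) \<alpha> = 0"
      "\<And>p. p \<in> {1..2*m} - {q} \<Longrightarrow> \<phi> p \<alpha> = 0" "\<phi> q \<alpha> \<noteq> 0"
    unfolding Gamma1_def ker_def by blast
  define \<beta> where "\<beta> = (if \<phi> q \<alpha> = 2 then \<alpha> + \<alpha> else \<alpha>)"
  have \<beta>0: "\<phi> p \<beta> = 0" if "p \<in> {1..2*m+1} - {q}" for p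
  proof -
    have "\<phi> p \<alpha> = 0" using that \<alpha> by (cases "p = 2*m+1") auto
    then show ?thesis using that phi_add[of p] by (auto simp: \<beta>_def)
  qed
  have qn: "q \<in> {1..2*m+1}" using q by simp
  have \<beta>: "\<phi> q \<beta> \<noteq> 0" "\<phi> q \<beta> \<noteq> 2"
    using \<alpha>(3) phi_add[OF qn, of \<alpha> \<alpha>] by (auto simp: \<beta>_def)
  have "(\<Sum>p\<in>mho1 m \<phi>. \<phi> p \<beta>) = (\<Sum>p\<in>{q}. \<phi> p \<beta>)"
    using q1 by (intro sum.mono_neutral_right finite_mho) (auto simp: mho1_def intro!: \<beta>0)
  then have D: "D (xpow \<beta> 0) = cst (\<phi> q \<beta>) * xpow \<beta> 0"
    by (simp add: D_xpow)
  have "dd q (xpow \<beta> 0) * Poly_Mapping.single (- \<beta>, 0) (inverse (\<phi> q \<beta>)) = 1"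
    using \<beta> by (simp add: dd_xpow mult_single zero_prod_def[symmetric])
  moreover have "Poly_Mapping.single (- \<beta>, 0) (inverse (\<phi> q \<beta>)) \<in> A"
    by (intro A_single multi_indices_0)
  ultimately show ?thesis
    unfolding direction_def using D \<beta> \<beta>0 multi_indices_0
    by (intro exI[of _ "xpow \<beta> 0"] exI[of _ "\<phi> q \<beta>"]) (auto simp: dd_xpow)
next
  assume q2: "q \<in> mho2 m \<phi>" and \<phi>q: "\<And>\<alpha>. \<phi> q \<alpha> = 0"
  let ?t = "xpow 0 (Poly_Mapping.single q 1) :: ('g, 'k) alg"
  have "J q = UNIV" using phi_or_J[of q] q \<phi>q by auto
  moreover have "0 \<in> J p" if "p \<in> {1..2*m+1}" for p using J_cases[OF that] by auto
  ultimately have j: "Poly_Mapping.single q 1 \<in> multi_indices m J"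
    using q by (auto simp: multi_indices_def lookup_single when_def)
  have dt: "dd r ?t = (if r = q then 1 else 0)" if "r \<in> {1..2*m+1}" for r
    using phi_0[OF that] by (auto simp: xpow_def pd_single lookup_single when_def zero_prod_def[symmetric])
  have "(\<Sum>p\<in>mho1 m \<phi>. \<phi> p 0) = 0"
    by (intro sum.neutral) (auto simp: mho1_def phi_0)
  moreover have "(\<Sum>p\<in>mho2 m \<phi>. of_nat (Poly_Mapping.lookup (Poly_Mapping.single q 1) p)) =
      (\<Sum>p\<in>mho2 m \<phi>. if p = q then 1 else 0 :: 'k)"
    by (intro sum.cong) (auto simp: lookup_single when_def)
  ultimately have "deg_eigenvalue m \<phi> 0 (Poly_Mapping.single q 1) = 1"
    using q2 by (simp add: deg_eigenvalue_def finite_mho)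
  then have "D ?t = cst 1 * ?t"
    by (simp add: xpow_def deg_der_single)
  moreover have "\<exists>r\<in>A. dd q ?t * r = 1"
    using dt[of q] q A_1 by (intro bexI[of _ 1]) auto
  ultimately show ?thesis
    unfolding direction_def using dt j
    by (intro exI[of _ ?t] exI[of _ 1]) auto
qed

lemma direction_in_A: "direction q b d \<Longrightarrow> b \<in> A"
  by (auto simp: direction_def A_xpow)

lemma direction_cancel: "direction q b d \<Longrightarrow> b * y = 0 \<Longrightarrow> y = 0"
  using xpow_mult_eq_0 by (auto simp: direction_def)

lemma direction_Z: "direction q b d \<Longrightarrow> q \<in> {1..2*m} \<Longrightarrow> Z b = 0"
  by (simp add: direction_def Z_def)

text \<open>
  Only the summand of \<open>P\<close> for the pair of \<open>q\<close> survives; the sign records whether \<open>q\<close> is the first or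
  the second index of that pair.
\<close>

lemma direction_P:
  assumes b: "direction q b d" and q: "q \<in> {1..2*m}"
  shows "P b v = (if q \<le> m then 1 else - 1) * xs q * dd q b * dd (conj_index m q) v"
proof -
  have d0: "dd r b = 0" if "r \<in> {1..2*m+1}" "r \<noteq> q" for r
    using b that by (auto simp: direction_def)
  define p0 where "p0 = (if q \<le> m then q else conj_index m q)"
  have p0: "p0 \<in> {1..m}" using q by (auto simp: p0_def conj_index_def)
  have "P b v = (\<Sum>p\<in>{p0}. bivec (xs p) (dd p) (dd (conj_index m p)) b v)"
    unfolding P_def
  proof (rule sum.mono_neutral_right)
    show "\<forall>p\<in>{1..m} - {p0}. bivec (xs p) (dd p) (dd (conj_index m p)) b v = 0"
    proof
      fix p assume p: "p \<in> {1..m} - {p0}"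
      then have "p \<noteq> q" "conj_index m p \<noteq> q"
        using q by (auto simp: p0_def conj_index_def split: if_splits)
      then have "dd p b = 0" "dd (conj_index m p) b = 0"
        using p by (auto intro!: d0 simp: conj_index_def)
      then show "bivec (xs p) (dd p) (dd (conj_index m p)) b v = 0" by (simp add: bivec_def)
    qed
  qed (use p0 in auto)
  also have "\<dots> = (if q \<le> m then 1 else - 1) * xs q * dd q b * dd (conj_index m q) v"
  proof (cases "q \<le> m")
    case True
    then have "dd (conj_index m q) b = 0"
      using q conj_index[OF q] by (intro d0) auto
    then show ?thesis using True by (simp add: p0_def bivec_def mult_ac)
  next
    case False
    then have "dd (conj_index m q) b = 0"
      using q conj_index[OF q] by (intro d0) auto
    then show ?thesis
      using False conj_index(2)[OF q] sigma_conj[OF q] by (simp add: p0_def bivec_def mult_ac)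
  qed
  finally show ?thesis .
qed

lemma P_eq_0: "(\<And>r. r \<in> {1..2*m} \<Longrightarrow> dd r g = 0) \<Longrightarrow> P g v = 0"
  unfolding P_def bivec_def
  by (intro sum.neutral ballI) (simp add: conj_index_def)

text \<open>
  If \<open>\<phi>\<^sub>n \<noteq> 0\<close>, the decomposition \<open>\<Gamma> = \<Gamma>\<^sub>1 + \<Gamma>\<^sub>2\<close> provides \<open>\<gamma> \<in> \<Gamma>\<^sub>2\<close> with \<open>\<phi>\<^sub>n(\<gamma>) \<noteq> 0\<close>, and \<open>x\<^sup>\<gamma>\<close> works.
  If \<open>\<phi>\<^sub>n = 0\<close>, then \<open>\<sigma>\<^sub>n\<close> lies in every kernel and is \<open>0\<close>, so \<open>Z = \<partial>\<^sub>n\<close>, and the last coordinate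
  function works.
\<close>

lemma central_exists:
  "\<exists>g\<in>A. (\<forall>v. P g v = 0) \<and> D g = 0 \<and> (\<exists>h\<in>A. Z g * h = 1)"
proof (cases "\<exists>\<alpha>. \<phi> (2*m+1) \<alpha> \<noteq> 0")
  case True
  have n: "2*m+1 \<in> {1..2*m+1}" by simp
  from True obtain \<alpha> where \<alpha>: "\<phi> (2*m+1) \<alpha> \<noteq> 0" by blast
  from Gamma_sum obtain \<beta> \<gamma> where bg: "\<beta> \<in> Gamma1 m \<phi>" "\<gamma> \<in> Gamma2 m \<phi>" "\<alpha> = \<beta> + \<gamma>" by blast
  define f where "f = \<phi> (2*m+1) \<gamma>"
  have f: "f \<noteq> 0"
    using \<alpha> bg phi_add[OF n, of \<beta> \<gamma>] by (simp add: Gamma1_def ker_def f_def)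
  have \<gamma>: "\<phi> p \<gamma> = 0" if "p \<in> {1..2*m}" for p
    using bg(2) that by (auto simp: Gamma2_def ker_def)
  let ?g = "xpow \<gamma> 0 :: ('g, 'k) alg"
  let ?h = "Poly_Mapping.single (- (\<sigma> (2*m+1) + \<gamma>), 0) (inverse f) :: ('g, 'k) alg"
  have "(\<Sum>p\<in>mho1 m \<phi>. \<phi> p \<gamma>) = 0"
    using \<gamma> by (intro sum.neutral) (auto simp: mho1_def)
  then have "D ?g = 0" by (simp add: D_xpow)
  moreover have "P ?g v = 0" for v
    by (rule P_eq_0) (simp add: dd_xpow \<gamma>)
  moreover have "Z ?g * ?h = 1"
    unfolding Z_def dd_xpow f_def[symmetric] using f
    by (simp add: xpow_def mult_single zero_prod_def[symmetric])
  moreover have "?g \<in> A" "?h \<in> A"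
    by (intro A_xpow A_single multi_indices_0)+
  ultimately show ?thesis by blast
next
  case False
  then have \<phi>n: "\<phi> (2*m+1) \<alpha> = 0" for \<alpha> by blast
  have \<sigma>: "\<sigma> (2*m+1) = 0"
  proof (rule phi_all_0)
    fix p assume "p \<in> {1..2*m+1}"
    then show "\<phi> p (\<sigma> (2*m+1)) = 0"
      using \<phi>n sigma_last by (cases "p = 2*m+1") (auto simp: Gamma2_def ker_def)
  qed
  let ?e = "Poly_Mapping.single (2*m+1) (1::nat)"
  let ?g = "xpow 0 ?e :: ('g, 'k) alg"
  have "J (2*m+1) = UNIV" using phi_or_J[of "2*m+1"] \<phi>n by auto
  moreover have "0 \<in> J p" if "p \<in> {1..2*m+1}" for p using J_cases[OF that] by auto
  ultimately have "?e \<in> multi_indices m J"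
    by (auto simp: multi_indices_def lookup_single when_def)
  then have "?g \<in> A" by (rule A_xpow)
  moreover have "P ?g v = 0" for v
    by (rule P_eq_0) (simp add: xpow_def pd_single lookup_single when_def phi_0)
  moreover have "D ?g = 0"
  proof -
    have "deg_eigenvalue m \<phi> 0 ?e = 0"
      by (auto simp: deg_eigenvalue_def mho1_def mho2_def lookup_single when_def phi_0)
    then show ?thesis by (simp only: xpow_def deg_der_single) simp
  qed
  moreover have "Z ?g * 1 = 1"
    unfolding Z_def using \<sigma> \<phi>n
    by (simp add: xpow_0 xpow_def pd_single zero_prod_def[symmetric])
  ultimately show ?thesis using A_1 by blast
qed

text \<open>
  Suppose \<open>I\<close> consists of elements of degree \<open>2\<close>.  For \<open>b\<close> of degree \<open>d\<close> and \<open>u \<in> I\<close>, the two parts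
  of \<open>[b, u] = P(b, u) + (2 - d) b Z(u)\<close> have degrees \<open>d\<close> and \<open>d + 2\<close>.  Their sum has degree \<open>2\<close>
  and \<open>d\<close> is neither \<open>0\<close> nor \<open>2\<close>, so both parts vanish.  Letting \<open>b\<close> run through all directions,
  every \<open>\<partial>\<^sub>p u\<close> vanishes and \<open>u\<close> is a constant, of degree \<open>0\<close>.
\<close>

lemma exists_not_of_degree_two:
  assumes I: "bracket_ideal I" and u: "u \<in> I" "u \<noteq> 0"
  shows "\<exists>u\<in>I. 2 * u - D u \<noteq> 0"
proof (rule ccontr)
  assume "\<not> ?thesis"
  then have deg2: "D v = 2 * v" if "v \<in> I" for v using that by simp
  have uA: "u \<in> A" using ideal_sub[OF I u(1)] .
  have Du: "D u = 2 * u" using deg2[OF u(1)] .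
  have key: "Z u = 0 \<and> P b u = 0" if q: "q \<in> {1..2*m}" and b: "direction q b d" for q b d
  proof -
    define X Y where "X = P b u" and "Y = b * Z u"
    have Db: "D b = cst d * b" and d: "d \<noteq> 0" "d \<noteq> 2" using b by (auto simp: direction_def)
    have bracket: "bracket b u = X + (2 - cst d) * Y"
      unfolding bracket_def X_def Y_def by (simp add: direction_Z[OF b q] Db algebra_simps)
    have DX: "D X = cst d * X" unfolding X_def by (simp add: der_simps Db Du algebra_simps)
    have DY: "D Y = (cst d + 2) * Y" unfolding Y_def by (simp add: der_simps Db Du algebra_simps)
    have "D (bracket b u) = 2 * bracket b u"
      by (intro deg2 ideal_bracket I u direction_in_A[OF b])
    then have "cst (d - 2) * (X - cst d * Y) = 0"
      unfolding bracket by (simp add: der_simps DX DY sc_diff algebra_simps)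
    then have X: "X = cst d * Y" using cst_cancel[of "d - 2"] d by force
    have "cst d * (cst d * Y) = D X" by (simp add: DX X[symmetric])
    also have "\<dots> = cst d * ((cst d + 2) * Y)" by (simp add: X der_simps DY)
    finally have "cst (2 * d) * Y = 0" by (simp add: sc_mult algebra_simps)
    then have "Y = 0" using cst_cancel[of "2 * d"] d by simp
    then show ?thesis using X direction_cancel[OF b] by (simp add: X_def Y_def)
  qed
  have "dd p u = 0" if p: "p \<in> {1..2*m+1}" for p
  proof (cases "p = 2*m+1")
    case True
    have "1 \<in> {1..2*m}" using m_pos by simp
    then have "Z u = 0" using key direction_exists by blast
    then show ?thesis
      unfolding True Z_def by (rule xpow_mult_eq_0)
  next
    case False
    then have p': "p \<in> {1..2*m}" using p by simp
    define q where "q = conj_index m p"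
    have q: "q \<in> {1..2*m}" "conj_index m q = p" using conj_index[OF p'] by (auto simp: q_def)
    obtain b d where b: "direction q b d" using direction_exists[OF q(1)] by blast
    then obtain r where r: "dd q b * r = 1" by (auto simp: direction_def)
    have "P b u = 0" using key[OF q(1) b] by simp
    then have "xs q * (dd q b * dd p u) = 0"
      unfolding direction_P[OF b q(1)] q(2) by (simp add: mult.assoc split: if_splits)
    then have "dd q b * dd p u = 0" by (rule xpow_mult_eq_0)
    then show ?thesis by (rule unit_mult_eq_0[OF r])
  qed
  then obtain c where c: "u = cst c" using constant_if_all_dd_0[OF uA] by blast
  have "2 * u = 0" using Du D_cst by (simp add: c)
  then have "cst 2 * u = 0" by (simp add: sc_numeral)
  then show False using cst_cancel[of 2 u] u by simp
qed

section \<open>Simplicity\<close>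

text \<open>
  The elements all of whose multiples lie in \<open>T\<close> are stable under the bracket.  Bracketing them with
  \<open>1\<close> gives stability under \<open>Z\<close>, and bracketing with the elements adapted to the conjugate
  of \<open>p\<close> gives stability under \<open>\<partial>\<^sub>p\<close>.  Differential simplicity applies.
\<close>

lemma lie_ideal_containing_ideal_is_everything:
  assumes T: "bracket_ideal T" and y: "y \<in> A" "y \<noteq> 0" "\<And>c. c \<in> A \<Longrightarrow> c * y \<in> T"
  shows "T = A"
proof -
  define N where "N = {w \<in> A. \<forall>c\<in>A. c * w \<in> T}"
  have mult: "a * w \<in> N" if "a \<in> A" "w \<in> N" for a w
    using that by (auto simp: N_def A_mult mult.assoc[symmetric])
  have add: "v - w \<in> N" if "v \<in> N" "w \<in> N" for v w
    using that ideal_diff[OF T] by (auto simp: N_def A_diff right_diff_distrib)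
  have bracket_N: "bracket b w \<in> N" if "b \<in> A" "w \<in> N" for b w
  proof -
    have "bracket b w \<in> A" unfolding bracket_def using that by (intro A_closed) (auto simp: N_def)
    then show ?thesis using associative_core_bracket[OF T that(1)] that(2) by (auto simp: N_def)
  qed
  have Z_N: "Z w \<in> N" if w: "w \<in> N" for w
  proof -
    have "cst (1/2) * bracket 1 w \<in> N" by (intro mult A_cst bracket_N A_1 w)
    moreover have "cst (1/2) * bracket 1 w = Z w"
    proof -
      have "cst (1/2) * bracket 1 w = cst (1/2 * 2) * Z w"
        unfolding bracket_one cst_mult by (simp add: mult.assoc)
      then show ?thesis by simp
    qed
    ultimately show ?thesis by simp
  qed
  have cancel: "w \<in> N" if "r \<in> A" "x * r = 1" "x * w \<in> N" for x r w
  proof -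
    have "r * (x * w) = (x * r) * w" by (simp add: mult_ac)
    then show ?thesis using mult[OF that(1,3)] that(2) by simp
  qed
  have "dd p w \<in> N" if p: "p \<in> {1..2*m+1}" and w: "w \<in> N" for p w
  proof (cases "p = 2*m+1")
    case True
    show ?thesis
      using Z_N[OF w] cancel[OF A_xpow[OF multi_indices_0] xpow_unit] unfolding True Z_def by blast
  next
    case False
    then have p': "p \<in> {1..2*m}" using p by simp
    define q where "q = conj_index m p"
    have q: "q \<in> {1..2*m}" "conj_index m q = p" using conj_index[OF p'] by (auto simp: q_def)
    obtain b d where b: "direction q b d" using direction_exists[OF q(1)] by blast
    then obtain r where r: "r \<in> A" "dd q b * r = 1" by (auto simp: direction_def)
    have bA: "b \<in> A" and Db: "D b = cst d * b"
      using b by (auto simp: direction_def intro: A_xpow)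
    have "bracket b w = P b w + (2 - cst d) * b * Z w"
      unfolding bracket_def using direction_Z[OF b q(1)] Db by (simp add: algebra_simps)
    then have "P b w = bracket b w - (2 - cst d) * b * Z w" by simp
    also have "\<dots> \<in> N"
      by (intro add mult bracket_N Z_N w A_closed bA)
    finally have "(if q \<le> m then 1 else - 1) * (xs q * (dd q b * dd p w)) \<in> N"
      unfolding direction_P[OF b q(1)] q(2) by (simp add: mult.assoc)
    then have "xs q * (dd q b * dd p w) \<in> N"
      using mult[of "-1" "- (xs q * (dd q b * dd p w))"] A_uminus[OF A_1]
      by (auto split: if_splits)
    then have "dd q b * dd p w \<in> N"
      using cancel[OF A_xpow[OF multi_indices_0] xpow_unit] by blast
    then show ?thesis using cancel[OF r] by blast
  qed
  moreover have "y \<in> N" using y by (simp add: N_def)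
  ultimately have "1 \<in> N"
    using y mult by (intro differential_simplicity[of N y]) (auto simp: N_def)
  then have "A \<subseteq> T" by (auto simp: N_def)
  then show ?thesis using T by (auto simp: bracket_ideal_def)
qed

text \<open>
  Modulo \<open>[A, A]\<close> one may integrate by parts: \<open>Z\<close>, \<open>4 - D\<close>, and each \<open>\<partial>\<^sub>p + 1\<close> (for \<open>p\<close> in \<open>mho1\<close>)
  or \<open>\<partial>\<^sub>p\<close> (for \<open>p\<close> in \<open>mho2\<close>) have values in \<open>[A, A]\<close>.  On a monomial, \<open>\<partial>\<^sub>p + 1\<close> resp. \<open>\<partial>\<^sub>p t\<^sub>p\<close>,
  with \<open>t\<^sub>p\<close> the coordinate function, acts by \<open>k\<^sub>p + 1\<close> up to a term of lower total degree, and
  the eigenvalue of \<open>D\<close> is the sum of the \<open>k\<^sub>p\<close>.  Adding all of these to \<open>4 - D\<close> leaves the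
  nonzero scalar \<open>4 + 2 m\<close>.
\<close>

lemma derived_algebra_is_everything:
  assumes I: "bracket_ideal I" and br: "\<And>a u. a \<in> A \<Longrightarrow> u \<in> A \<Longrightarrow> bracket a u \<in> I"
  shows "I = A"
proof -
  have Z_I: "Z y \<in> I" if "y \<in> A" for y
    using br[OF A_1 that] ideal_numeral_cancel[OF I] unfolding bracket_one by blast
  have F_I: "F y \<in> I" if y: "y \<in> A" for y
  proof -
    obtain g h where g: "g \<in> A" "\<And>v. P g v = 0" "D g = 0" and h: "h \<in> A" "Z g * h = 1"
      using central_exists by blast
    have "bracket (g * h) y - bracket h (g * y) \<in> I" by (intro ideal_diff I br A_mult g h y)
    then have "- F y \<in> I" unfolding central_exchange[OF g(2,3)] by (simp add: h)
    then show ?thesis using ideal_uminus[OF I] by force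
  qed
  have dd_I: "dd p y + cst (1 - deg_drop p) * y \<in> I" if p: "p \<in> {1..2*m}" and y: "y \<in> A" for p y
  proof -
    define q where "q = conj_index m p"
    have q: "q \<in> {1..2*m}" "conj_index m q = p" using conj_index[OF p] by (auto simp: q_def)
    have xq: "xs q = xs p" using sigma_conj[OF p] by (simp add: q_def)
    obtain b d where b: "direction q b d" using direction_exists[OF q(1)] by blast
    then obtain r where r: "r \<in> A" "dd q b * r = 1" by (auto simp: direction_def)
    have bA: "b \<in> A" and Db: "D b = cst d * b"
      using b by (auto simp: direction_def intro: A_xpow)
    have dpb: "dd p b = 0" using b p conj_index[OF p] by (auto simp: direction_def q_def)
    have der: "derivation (dd p)" using p by (intro dd_der) simp
    \<comment> \<open>Up to sign \<open>P b = e * dd p\<close> with the unit \<open>e\<close>.  Evaluating at \<open>e' * y\<close> cancels \<open>e\<close>, and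
      differentiating \<open>e'\<close> produces the summand \<open>y\<close> on \<open>mho1\<close>.\<close>
    define e e' where "e = xs p * dd q b" and "e' = xpow (- \<sigma> p) 0 * r"
    have ee: "e * e' = 1"
    proof -
      have "e * e' = (xs p * xpow (- \<sigma> p) 0) * (dd q b * r)"
        by (simp add: e_def e'_def mult_ac)
      then show ?thesis by (simp add: xpow_unit r)
    qed
    have e'A: "e' \<in> A" unfolding e'_def by (intro A_closed A_xpow multi_indices_0 r)
    have "dd p (xs p) = - (cst (1 - deg_drop p) * xs p)"
    proof (rule mho_cases[OF p])
      assume "p \<in> mho1 m \<phi>" "p \<notin> mho2 m \<phi>"
      then show ?thesis by (simp add: dd_xpow sigma_norm deg_drop_def) (simp add: xpow_def single_uminus)
    next
      assume "p \<in> mho2 m \<phi>"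
      then show ?thesis using p by (simp add: dd_xpow sigma_zero deg_drop_def phi_0)
    qed
    moreover have "dd p (dd q b) = 0"
      unfolding pd_commute[of \<phi> p q] dpb using q by (intro derivation_0 dd_der) simp
    ultimately have de: "dd p e = - (cst (1 - deg_drop p) * e)"
      by (simp add: e_def derivation_mult[OF der] algebra_simps)
    have v: "e' * y \<in> A" using e'A y by (rule A_mult)
    have "b * Z (e' * y) = Z (b * (e' * y))"
      by (simp add: derivation_mult[OF Z_derivation] direction_Z[OF b q(1)])
    then have bZ: "b * Z (e' * y) \<in> I" using Z_I A_mult[OF bA v] by simp
    have "bracket b (e' * y) = P b (e' * y) + cst (2 - d) * (b * Z (e' * y))"
      unfolding bracket_def using direction_Z[OF b q(1)] Db by (simp add: sc_diff algebra_simps)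
    then have "P b (e' * y) = bracket b (e' * y) - cst (2 - d) * (b * Z (e' * y))" by simp
    also have "\<dots> \<in> I" by (intro ideal_diff ideal_sc I br bA v bZ)
    finally have "(if q \<le> m then 1 else - 1) * (e * dd p (e' * y)) \<in> I"
      unfolding direction_P[OF b q(1)] q(2) xq e_def by (simp add: mult.assoc)
    then have 1: "e * dd p (e' * y) \<in> I"
      using ideal_uminus[OF I, of "- (e * dd p (e' * y))"] by (auto split: if_splits)
    have "e * dd p (e' * y) = dd p (e * (e' * y)) - dd p e * (e' * y)"
      by (simp add: derivation_mult[OF der])
    also have "\<dots> = dd p ((e * e') * y) + cst (1 - deg_drop p) * ((e * e') * y)"
      by (simp add: de mult_ac)
    finally show ?thesis using 1 by (simp add: ee)
  qed
  have mono: "Poly_Mapping.single (\<alpha>, i) c \<in> I" if "i \<in> multi_indices m J" for \<alpha> i c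
    using that
  proof (induction "total_degree i" arbitrary: i c rule: less_induct)
    case less
    define k where "k q = (if q \<in> mho1 m \<phi> then \<phi> q \<alpha> else of_nat (Poly_Mapping.lookup i q))" for q
    have step: "Poly_Mapping.single (\<alpha>, i) (c * (k q + 1)) \<in> I" if q: "q \<in> {1..2*m}" for q c
    proof (rule mho_cases[OF q])
      assume q1: "q \<in> mho1 m \<phi>" "q \<notin> mho2 m \<phi>"
      let ?l = "Poly_Mapping.single (\<alpha>, i - Poly_Mapping.single q 1) (c * of_nat (Poly_Mapping.lookup i q))"
      have "dd q (Poly_Mapping.single (\<alpha>, i) c) + cst (1 - deg_drop q) * Poly_Mapping.single (\<alpha>, i) c \<in> I"
        by (intro dd_I q A_single less.prems)
      moreover have "?l \<in> I"
      proof (cases "Poly_Mapping.lookup i q = 0")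
        case True
        then show ?thesis using ideal_0[OF I] by simp
      next
        case False
        then have "total_degree (i - Poly_Mapping.single q 1) < total_degree i"
          using total_degree_minus[of q i] q by simp
        then show ?thesis
          by (rule less.hyps) (rule multi_indices_lower[OF less.prems])
      qed
      ultimately have "dd q (Poly_Mapping.single (\<alpha>, i) c) +
          cst (1 - deg_drop q) * Poly_Mapping.single (\<alpha>, i) c - ?l \<in> I"
        by (intro ideal_diff I)
      then show ?thesis
        using q1 by (simp add: pd_single deg_drop_def k_def distrib_left single_add)
    next
      assume q2: "q \<in> mho2 m \<phi>" "q \<notin> mho1 m \<phi>" and \<phi>q: "\<And>\<alpha>. \<phi> q \<alpha> = 0"
      have "J q = UNIV" using phi_or_J[of q] q \<phi>q by auto
      moreover have "0 \<in> J p" if "p \<in> {1..2*m+1}" for p using J_cases[OF that] by auto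
      ultimately have e: "Poly_Mapping.single q 1 \<in> multi_indices m J"
        using q by (auto simp: multi_indices_def lookup_single when_def)
      let ?y = "Poly_Mapping.single (\<alpha>, i + Poly_Mapping.single q 1) c"
      have "dd q ?y + cst (1 - deg_drop q) * ?y \<in> I"
        by (intro dd_I q A_single multi_indices_add less.prems e)
      then show ?thesis
        using q2 \<phi>q by (simp add: pd_single deg_drop_def k_def lookup_add add_ac)
    qed
    have sumk: "(\<Sum>q=1..2*m. k q) = deg_eigenvalue m \<phi> \<alpha> i"
    proof -
      have "{1..2*m} = mho1 m \<phi> \<union> mho2 m \<phi>" "mho1 m \<phi> \<inter> mho2 m \<phi> = {}"
        by (auto simp: mho1_def mho2_def)
      then have "(\<Sum>q=1..2*m. k q) = (\<Sum>q\<in>mho1 m \<phi>. k q) + (\<Sum>q\<in>mho2 m \<phi>. k q)"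
        by (simp add: sum.union_disjoint finite_mho)
      also have "\<dots> = deg_eigenvalue m \<phi> \<alpha> i"
        unfolding deg_eigenvalue_def by (intro arg_cong2[where f = "(+)"] sum.cong) (auto simp: k_def mho2_def)
      finally show ?thesis .
    qed
    define c' where "c' = c / (4 + 2 * of_nat m)"
    have nz: "(4 + 2 * of_nat m :: 'k) \<noteq> 0"
      using of_nat_neq_0[of "3 + 2 * m", where 'a = 'k] by (simp add: add_ac)
    have Fs: "F (Poly_Mapping.single (\<alpha>, i) c') = Poly_Mapping.single (\<alpha>, i) (c' * (4 - deg_eigenvalue m \<phi> \<alpha> i))"
    proof -
      have "4 * Poly_Mapping.single (\<alpha>, i) c' = cst 4 * Poly_Mapping.single (\<alpha>, i) c'" by simp
      then show ?thesis
        unfolding F_def deg_der_single cst_mult_single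
        by (simp add: single_diff[symmetric] algebra_simps)
    qed
    have sums: "(\<Sum>q\<in>S. Poly_Mapping.single (\<alpha>, i) (c' * (k q + 1))) \<in> I"
      if "finite S" "S \<subseteq> {1..2*m}" for S
      using that by (induction S) (auto intro!: ideal_0 ideal_add I step)
    have ssum: "(\<Sum>q\<in>S. Poly_Mapping.single x (f q)) = Poly_Mapping.single x (\<Sum>q\<in>S. f q :: 'k)" for S x f
      by (induction S rule: infinite_finite_induct) (simp_all add: single_add)
    have "F (Poly_Mapping.single (\<alpha>, i) c') + (\<Sum>q=1..2*m. Poly_Mapping.single (\<alpha>, i) (c' * (k q + 1))) \<in> I"
      by (intro ideal_add I F_I A_single less.prems sums) auto
    also have "F (Poly_Mapping.single (\<alpha>, i) c') + (\<Sum>q=1..2*m. Poly_Mapping.single (\<alpha>, i) (c' * (k q + 1))) =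
        Poly_Mapping.single (\<alpha>, i) c"
    proof -
      have "c' * (4 - deg_eigenvalue m \<phi> \<alpha> i) + (\<Sum>q=1..2*m. c' * (k q + 1)) = c' * (4 + 2 * of_nat m)"
        unfolding sum_distrib_left[symmetric] sum.distrib sumk by (simp add: algebra_simps)
      also have "\<dots> = c" using nz by (simp add: c'_def)
      finally show ?thesis
        unfolding Fs ssum single_add[symmetric] by simp
    qed
    finally show ?case .
  qed
  have "u \<in> I" if "u \<in> A" for u
    using that by (induction u rule: A_induct) (auto intro: mono ideal_add I)
  then show ?thesis using I by (auto simp: bracket_ideal_def)
qed

lemma bracket_ideal_trivial:
  assumes I: "bracket_ideal I"
  shows "I = {0} \<or> I = A"
proof (rule disjCI)
  assume "I \<noteq> A"
  show "I = {0}"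
  proof (rule ccontr)
    assume "I \<noteq> {0}"
    then obtain u where u: "u \<in> I" "u \<noteq> 0" using ideal_0[OF I] by blast
    obtain w where w: "w \<in> I" "2 * w - D w \<noteq> 0" using exists_not_of_degree_two[OF I u] by blast
    obtain g h where g: "g \<in> A" "\<And>v. P g v = 0" "D g = 0" and h: "h \<in> A" "Z g * h = 1"
      using central_exists by blast
    have 1: "1 \<in> {1..2*m}" using m_pos by simp
    obtain b d where b: "direction 1 b d" using direction_exists[OF 1] by blast
    then have Db: "D b = cst d * b" "d \<noteq> 0" by (auto simp: direction_def)
    obtain y where y: "y \<in> A" "y \<noteq> 0" "\<And>c a. c \<in> A \<Longrightarrow> a \<in> A \<Longrightarrow> bracket a (c * y) \<in> I"
      using transporter_contains_associative_ideal[OF I g h direction_in_A[OF b] direction_Z[OF b 1]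
          Db direction_cancel[OF b] w] by blast
    have "{t \<in> A. \<forall>a\<in>A. bracket a t \<in> I} = A"
      using lie_ideal_containing_ideal_is_everything[OF transporter_ideal[OF I], of y] y by (auto simp: A_mult)
    then have "I = A" by (intro derived_algebra_is_everything[OF I]) blast
    with \<open>I \<noteq> A\<close> show False ..
  qed
qed

lemma contact_lie_algebra: "lie_algebra scale_alg A (contact_bracket m \<phi> \<sigma>)"
proof -
  interpret vector_space "scale_alg :: 'k \<Rightarrow> ('g, 'k) alg \<Rightarrow> ('g, 'k) alg"
    by unfold_locales (simp_all add: scale_alg_eq sc_add cst_mult algebra_simps)
  have [simp]: "bracket u (v + w) = bracket u v + bracket u w" "bracket (u + v) w = bracket u w + bracket v w"
    "bracket u (cst c * v) = cst c * bracket u v" "bracket (cst c * u) v = cst c * bracket u v" for u v w c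
    unfolding bracket_def by (simp_all add: der_simps algebra_simps)
  show ?thesis
  proof
    show "subspace A"
      by (auto simp: subspace_def scale_alg_eq A_0 A_add A_mult A_cst)
    show "contact_bracket m \<phi> \<sigma> u v \<in> A" if "u \<in> A" "v \<in> A" for u v
      unfolding contact_bracket_eq bracket_def using that by (intro A_closed)
  qed (simp_all add: contact_bracket_eq scale_alg_eq bracket_self bracket_jacobi)
qed

lemma contact_simple: "simple_lie_algebra scale_alg A (contact_bracket m \<phi> \<sigma>)"
proof -
  interpret lie: lie_algebra scale_alg A "contact_bracket m \<phi> \<sigma>"
    by (rule contact_lie_algebra)
  show ?thesis
  proof
    obtain g h where g: "g \<in> A" and h: "h \<in> A" "Z g * h = 1"
      using central_exists by blast
    have "bracket 1 g \<noteq> 0"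
    proof
      assume "bracket 1 g = 0"
      then have "cst 2 * Z g = 0" by (simp add: bracket_one)
      then have "Z g = 0" using cst_cancel[of 2 "Z g"] by simp
      then show False using h by simp
    qed
    then show "\<exists>u\<in>A. \<exists>v\<in>A. contact_bracket m \<phi> \<sigma> u v \<noteq> 0"
      unfolding contact_bracket_eq using g A_1 by blast
    fix I assume I: "lie.lie_ideal I"
    have "bracket_ideal I"
      using I by (auto simp: lie.lie_ideal_def bracket_ideal_def lie.subspace_def
          contact_bracket_eq scale_alg_eq)
    then show "I = {0} \<or> I = A" by (rule bracket_ideal_trivial)
  qed
qed

end

theorem theorem5p1:
  fixes m :: nat
    and J :: "nat \<Rightarrow> nat set"
    and \<phi> :: "nat \<Rightarrow> 'g::ab_group_add \<Rightarrow> 'k::field_char_0"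
    and \<sigma> :: "nat \<Rightarrow> 'g"
  assumes "contact_data m J \<phi> \<sigma>"
  shows "simple_lie_algebra scale_alg (alg_carrier m J :: ('g, 'k) alg set) (contact_bracket m \<phi> \<sigma>)"
  using assms by (rule contact_data.contact_simple)

end
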